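(* On the manifold of $n\times n$ CMV matrices with fixed determinant, for any $0\le k,l\le n-2$ the Gelfand--Dikij brackets of the Verblunsky coefficients are given by $$\{\alpha_k,\alpha_l\}=0\qquad\text{and}\qquad\{\alpha_k,\bar\alpha_l\}=-2i\,\delta_{kl}\,\rho_k^2 .$$ That is, the Gelfand--Dikij and Ablowitz--Ladik brackets agree.
   Context: CMV matrices: given Verblunsky coefficients $\alpha_0,\ldots,\alpha_{n-2}$ in the open unit disk $\mathbb{D}$ and $\alpha_{n-1}$ on the unit circle, put $\rho_k=\sqrt{1-|\alpha_k|^2}$, $\Xi_k=\begin{bmatrix}\bar\alpha_k&\rho_k\\ \rho_k&-\alpha_k\end{bmatrix}$ for $0\le k\le n-2$, and $1\times1$ matrices $\Xi_{-1}=[1]$, $\Xi_{n-1}=[\bar\alpha_{n-1}]$. The $n\times n$ CMV matrix with these coefficients is $\mathcal{C}=\mathcal{L}\mathcal{M}$, where $\mathcal{L}=\mathrm{diag}(\Xi_0,\Xi_2,\ldots)$, $\mathcal{M}=\mathrm{diag}(\Xi_{-1},\Xi_1,\Xi_3,\ldots)$ are $n\times n$ block-diagonal. As $\det\mathcal{C}=(-1)^{n-1}\bar\alpha_{n-1}$, the numbers $(\alpha_0,\ldots,\alpha_{n-2})\in\mathbb{D}^{n-1}$ are coordinates on the manifold of CMV matrices with fixed determinant. Gelfand--Dikij bracket: let $\mathfrak{g}$ be the $n\times n$ complex matrices viewed as a real manifold. Write $\mathfrak{g}=\mathfrak{l}\oplus\mathfrak{a}$, with $\mathfrak{a}=\{A:A=-A^\dagger\}$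 and $\mathfrak{l}$ the lower triangular matrices with real diagonal; $\pi_{\mathfrak l},\pi_{\mathfrak a}$ are the projections and $R=\pi_{\mathfrak l}-\pi_{\mathfrak a}$. Let $\langle X,Y\rangle=\mathrm{Im}\,\mathrm{tr}(XY)$ and define $\nabla\phi$ for smooth $\phi:\mathfrak g\to\mathbb R$ by $\frac{d}{dt}|_{t=0}\phi(B+tC)=\langle\nabla\phi|_B,C\rangle$. Then, with $X=\nabla\phi|_B$, $Y=\nabla\psi|_B$, $$\{\phi,\psi\}|_B=\tfrac12\langle R(XB),YB\rangle-\tfrac12\langle R(BX),BY\rangle .$$ The manifold of CMV matrices with fixed determinant is a symplectic leaf of this bracket, so the bracket restricts to functions on it (computed via arbitrary smooth extensions). Brackets are extended to complex-valued functions bilinearly over $\mathbb{C}$. Ablowitz--Ladik bracket: with $\alpha_j=u_j+iv_j$, $$\{f,g\}_2=\sum_{j=0}^{n-2}\rho_j^2\Big[\frac{\partial f}{\partial u_j}\frac{\partial g}{\partial v_j}-\frac{\partial f}{\partial v_j}\frac{\partial g}{\partial u_j}\Big].$$ *)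

theory Defs
  imports "HOL-Analysis.Analysis"
begin

text \<open>
  An \<open>n \<times> n\<close> matrix is an element of \<open>complex ^ 'n ^ 'n\<close> with \<open>n = CARD('n)\<close>.
  The index type is a finite linear order, so that triangular matrices make sense;
  \<open>idx\<close> is the order isomorphism of \<open>'n\<close> with \<open>{0, \<dots>, n - 1}\<close>.
\<close>

type_synonym 'n cmat = "complex ^ 'n ^ 'n"

definition idx :: "'n::{finite,linorder} \<Rightarrow> nat" where
  "idx i = card {..<i}"


subsection \<open>CMV matrices\<close>

text \<open>
  Verblunsky coefficients are sequences of which only the entries \<open>0, \<dots>, n - 1\<close> matter.
\<close>

definition verblunsky :: "nat \<Rightarrow> (nat \<Rightarrow> complex) \<Rightarrow> bool" where
  "verblunsky n \<alpha> \<longleftrightarrow> (\<forall>j < n - 1. cmod (\<alpha> j) < 1) \<and> cmod (\<alpha> (n - 1)) = 1"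

definition rho :: "(nat \<Rightarrow> complex) \<Rightarrow> nat \<Rightarrow> real" where
  "rho \<alpha> k = sqrt (1 - (cmod (\<alpha> k))\<^sup>2)"

text \<open>The entry in row \<open>r\<close> and column \<open>c\<close> (with \<open>r, c \<in> {0, 1}\<close>) of the block \<open>\<Xi>\<^sub>k\<close>.\<close>

definition Xi :: "(nat \<Rightarrow> complex) \<Rightarrow> nat \<Rightarrow> nat \<Rightarrow> nat \<Rightarrow> complex" where
  "Xi \<alpha> k r c =
    (if r = 0 \<and> c = 0 then cnj (\<alpha> k)
     else if r = 1 \<and> c = 1 then - \<alpha> k
     else of_real (rho \<alpha> k))"

text \<open>
  For \<open>k \<le> n - 2\<close> the block \<open>\<Xi>\<^sub>k\<close> occupies the rows and columns \<open>k\<close> and \<open>k + 1\<close>. Of the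
  block \<open>\<Xi>\<^sub>n\<^sub>-\<^sub>1\<close> only the upper left entry \<open>cnj (\<alpha> (n - 1))\<close> fits into the matrix, which is
  the required \<open>1 \<times> 1\<close> block. Even-numbered blocks go into \<open>\<L>\<close>, odd-numbered ones into \<open>\<M>\<close>,
  the latter preceded by the \<open>1 \<times> 1\<close> block \<open>\<Xi>\<^sub>-\<^sub>1 = [1]\<close>.
\<close>

definition L_entry :: "(nat \<Rightarrow> complex) \<Rightarrow> nat \<Rightarrow> nat \<Rightarrow> complex" where
  "L_entry \<alpha> i j =
    (if i div 2 = j div 2 then Xi \<alpha> (2 * (i div 2)) (i mod 2) (j mod 2) else 0)"

definition M_entry :: "(nat \<Rightarrow> complex) \<Rightarrow> nat \<Rightarrow> nat \<Rightarrow> complex" where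
  "M_entry \<alpha> i j =
    (if i = 0 \<and> j = 0 then 1
     else if Suc i div 2 = Suc j div 2
     then Xi \<alpha> (2 * (Suc i div 2) - 1) (Suc i mod 2) (Suc j mod 2)
     else 0)"

definition L_matrix :: "(nat \<Rightarrow> complex) \<Rightarrow> 'n::{finite,linorder} cmat" where
  "L_matrix \<alpha> = (\<chi> i j. L_entry \<alpha> (idx i) (idx j))"

definition M_matrix :: "(nat \<Rightarrow> complex) \<Rightarrow> 'n::{finite,linorder} cmat" where
  "M_matrix \<alpha> = (\<chi> i j. M_entry \<alpha> (idx i) (idx j))"

definition cmv :: "(nat \<Rightarrow> complex) \<Rightarrow> 'n::{finite,linorder} cmat" where
  "cmv \<alpha> = L_matrix \<alpha> ** M_matrix \<alpha>"


subsection \<open>Smooth functions\<close>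

fun diff_order_on :: "nat \<Rightarrow> ('a::real_normed_vector \<Rightarrow> 'b::real_normed_vector) \<Rightarrow> 'a set \<Rightarrow> bool"
  where
  "diff_order_on 0 f U \<longleftrightarrow> continuous_on U f"
| "diff_order_on (Suc k) f U \<longleftrightarrow>
     (\<forall>x\<in>U. f differentiable (at x)) \<and>
     (\<forall>v. diff_order_on k (\<lambda>x. frechet_derivative f (at x) v) U)"

text \<open>This is \<open>C\<^sup>\<infinity>\<close> over the reals; it is used for open \<open>U\<close> in finite dimension only.\<close>

definition smooth_fun_on :: "('a::real_normed_vector \<Rightarrow> 'b::real_normed_vector) \<Rightarrow> 'a set \<Rightarrow> bool"
  where
  "smooth_fun_on f U \<longleftrightarrow> (\<forall>k. diff_order_on k f U)"


subsection \<open>The Gelfand--Dikij bracket\<close>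

definition skew_hermitian :: "'n::{finite,linorder} cmat set" where
  "skew_hermitian = {A. A = - (\<chi> i j. cnj (A $ j $ i))}"

definition lower_real_diag :: "'n::{finite,linorder} cmat set" where
  "lower_real_diag = {A. (\<forall>i j. i < j \<longrightarrow> A $ i $ j = 0) \<and> (\<forall>i. A $ i $ i \<in> \<real>)}"

definition proj_l :: "'n::{finite,linorder} cmat \<Rightarrow> 'n cmat" where
  "proj_l X = (THE Y. Y \<in> lower_real_diag \<and> X - Y \<in> skew_hermitian)"

definition proj_a :: "'n::{finite,linorder} cmat \<Rightarrow> 'n cmat" where
  "proj_a X = (THE Y. Y \<in> skew_hermitian \<and> X - Y \<in> lower_real_diag)"

definition R_op :: "'n::{finite,linorder} cmat \<Rightarrow> 'n cmat" where
  "R_op X = proj_l X - proj_a X"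

definition pairing :: "'n::finite cmat \<Rightarrow> 'n cmat \<Rightarrow> real" where
  "pairing X Y = Im (trace (X ** Y))"

definition grad :: "('n::finite cmat \<Rightarrow> real) \<Rightarrow> 'n cmat \<Rightarrow> 'n cmat" where
  "grad \<phi> B =
    (THE X. \<forall>C. ((\<lambda>t. \<phi> (B + t *\<^sub>R C)) has_real_derivative pairing X C) (at 0))"

definition gd_bracket ::
  "('n::{finite,linorder} cmat \<Rightarrow> real) \<Rightarrow> ('n cmat \<Rightarrow> real)
    \<Rightarrow> 'n cmat \<Rightarrow> real" where
  "gd_bracket \<phi> \<psi> B =
    (let X = grad \<phi> B; Y = grad \<psi> B in
      1/2 * pairing (R_op (X ** B)) (Y ** B) - 1/2 * pairing (R_op (B ** X)) (B ** Y))"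


subsection \<open>The Ablowitz--Ladik bracket\<close>

definition partial_u :: "nat \<Rightarrow> ((nat \<Rightarrow> complex) \<Rightarrow> real) \<Rightarrow> (nat \<Rightarrow> complex) \<Rightarrow> real" where
  "partial_u j f \<alpha> = deriv (\<lambda>t::real. f (\<alpha>(j := \<alpha> j + of_real t))) 0"

definition partial_v :: "nat \<Rightarrow> ((nat \<Rightarrow> complex) \<Rightarrow> real) \<Rightarrow> (nat \<Rightarrow> complex) \<Rightarrow> real" where
  "partial_v j f \<alpha> = deriv (\<lambda>t::real. f (\<alpha>(j := \<alpha> j + \<i> * of_real t))) 0"

definition al_bracket ::
  "nat \<Rightarrow> ((nat \<Rightarrow> complex) \<Rightarrow> real) \<Rightarrow> ((nat \<Rightarrow> complex) \<Rightarrow> real) \<Rightarrow> (nat \<Rightarrow> complex) \<Rightarrow> real"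
  where
  "al_bracket n f g \<alpha> =
    (\<Sum>j < n - 1. (rho \<alpha> j)\<^sup>2 *
      (partial_u j f \<alpha> * partial_v j g \<alpha> - partial_v j f \<alpha> * partial_u j g \<alpha>))"


subsection \<open>Complex-valued functions and restriction to the manifold\<close>

text \<open>The extension of a bracket to complex-valued functions that is bilinear over \<open>\<complex>\<close>.\<close>

definition complexify ::
  "(('a \<Rightarrow> real) \<Rightarrow> ('a \<Rightarrow> real) \<Rightarrow> 'a \<Rightarrow> real) \<Rightarrow> ('a \<Rightarrow> complex) \<Rightarrow> ('a \<Rightarrow> complex) \<Rightarrow> 'a \<Rightarrow> complex"
  where
  "complexify br f g x =
    Complex (br (Re \<circ> f) (Re \<circ> g) x - br (Im \<circ> f) (Im \<circ> g) x)
            (br (Re \<circ> f) (Im \<circ> g) x + br (Im \<circ> f) (Re \<circ> g) x)"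

text \<open>
  A function on the manifold of CMV matrices with determinant \<open>det B\<close> is given as a function
  \<open>f\<close> of the Verblunsky coefficients. A smooth extension of it is only required to be defined
  on a neighbourhood of \<open>B\<close> in the space of all matrices, since a smooth function on
  \<open>\<bbbD>\<^sup>n\<^sup>-\<^sup>1\<close> may be unbounded.
\<close>

definition smooth_extension ::
  "((nat \<Rightarrow> complex) \<Rightarrow> complex) \<Rightarrow> ('n::{finite,linorder} cmat \<Rightarrow> complex)
    \<Rightarrow> 'n cmat \<Rightarrow> bool" where
  "smooth_extension f \<phi> B \<longleftrightarrow>
    (\<exists>U. open U \<and> B \<in> U \<and> smooth_fun_on \<phi> U \<and>
      (\<forall>\<beta>. verblunsky CARD('n) \<beta> \<and> det (cmv \<beta> :: 'n cmat) = det B \<and> cmv \<beta> \<in> U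
        \<longrightarrow> \<phi> (cmv \<beta>) = f \<beta>))"

text \<open>
  Smoothness of a function on the manifold near its point \<open>B\<close>, as usual for functions on a
  subset of a Euclidean space.
\<close>

definition smooth_on_manifold_at ::
  "((nat \<Rightarrow> complex) \<Rightarrow> complex) \<Rightarrow> 'n::{finite,linorder} cmat \<Rightarrow> bool" where
  "smooth_on_manifold_at f B \<longleftrightarrow> (\<exists>\<phi>. smooth_extension f \<phi> B)"

text \<open>
  The restriction of the Gelfand--Dikij bracket to the manifold is well defined for \<open>f\<close> and
  \<open>g\<close> at \<open>B\<close> and has the value \<open>c\<close>: smooth extensions exist, and all of them give \<open>c\<close>.
\<close>

definition has_manifold_gd_bracket ::
  "((nat \<Rightarrow> complex) \<Rightarrow> complex) \<Rightarrow> ((nat \<Rightarrow> complex) \<Rightarrow> complex)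
    \<Rightarrow> 'n::{finite,linorder} cmat \<Rightarrow> complex \<Rightarrow> bool" where
  "has_manifold_gd_bracket f g B c \<longleftrightarrow>
    smooth_on_manifold_at f B \<and> smooth_on_manifold_at g B \<and>
    (\<forall>\<phi> \<psi>. smooth_extension f \<phi> B \<and> smooth_extension g \<psi> B
      \<longrightarrow> complexify gd_bracket \<phi> \<psi> B = c)"

end

theory Submission
  imports Defs
begin

text \<open>
  Write \<open>V\<^sub>X(g) = (g R(Xg) - R(gX) g) / 2\<close>, so that the Gelfand--Dikij bracket at \<open>g\<close> is
  \<open>\<langle>\<nabla>\<psi>, V\<^sub>X(g)\<rangle>\<close> with \<open>X = \<nabla>\<phi>\<close>. It is multiplicative (matrix multiplication is a Poisson map):
  \<open>V\<^sub>X(AB) = A V\<^sub>X\<^sub>A(B) + V\<^sub>B\<^sub>X(A) B\<close>. A CMV matrix is a product of factors that equal the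
  identity up to one block \<open>\<Xi>\<^sub>k\<close>, and for such a factor a computation gives
  \<open>V\<^sub>X = \<rho>\<^sub>k\<^sup>2 (\<langle>X, \<partial>\<^sub>u\<rangle> \<partial>\<^sub>v - \<langle>X, \<partial>\<^sub>v\<rangle> \<partial>\<^sub>u)\<close>, where \<open>\<partial>\<^sub>u, \<partial>\<^sub>v\<close> are the derivatives of the factor
  along \<open>u\<^sub>k, v\<^sub>k\<close>. By the product rule the same formula, summed over \<open>k\<close>, holds for the CMV
  matrix itself. So \<open>V\<^sub>X\<close> is tangent to the manifold, and pairing it with \<open>\<nabla>\<psi>\<close> yields the
  Ablowitz--Ladik bracket by the chain rule.
\<close>

subsection \<open>Smooth functions\<close>

lemma frechet_derivative_cong_open:
  assumes "open U" "x \<in> U" "\<And>y. y \<in> U \<Longrightarrow> f y = g y"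
  shows "frechet_derivative f (at x) = frechet_derivative g (at x)"
proof -
  have "(f has_derivative D) (at x) \<longleftrightarrow> (g has_derivative D) (at x)" for D
    using assms by (metis has_derivative_transform_within_open)
  then show ?thesis by (simp add: frechet_derivative_def)
qed

text \<open>On an open set a derivative depends only on the values in the set, and so at every
  order. This lets a Frechet derivative be replaced by a formula that is known on \<open>U\<close>
  only.\<close>

lemma diff_order_on_cong:
  assumes "open U" "\<And>x. x \<in> U \<Longrightarrow> f x = g x"
  shows "diff_order_on k f U \<longleftrightarrow> diff_order_on k g U"
  using assms(2)
proof (induction k arbitrary: f g)
  case 0
  then show ?case by (simp cong: continuous_on_cong)
next
  case (Suc k)
  have "f differentiable (at x) \<longleftrightarrow> g differentiable (at x)" if "x \<in> U" for x
    unfolding differentiable_def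
    using assms(1) that Suc.prems by (metis has_derivative_transform_within_open)
  moreover have "diff_order_on k (\<lambda>x. frechet_derivative f (at x) v) U \<longleftrightarrow>
      diff_order_on k (\<lambda>x. frechet_derivative g (at x) v) U" for v
    by (rule Suc.IH) (metis frechet_derivative_cong_open assms(1) Suc.prems)
  ultimately show ?case by simp
qed

lemma diff_order_on_SucI:
  assumes "open U" "\<And>x. x \<in> U \<Longrightarrow> (f has_derivative f' x) (at x)"
    and "\<And>v. diff_order_on k (\<lambda>x. f' x v) U"
  shows "diff_order_on (Suc k) f U"
proof -
  have "frechet_derivative f (at x) = f' x" if "x \<in> U" for x
    using assms(2)[OF that] by (metis frechet_derivative_at)
  then have "diff_order_on k (\<lambda>x. frechet_derivative f (at x) v) U" for v
    using assms(3)[of v] by (subst diff_order_on_cong[OF assms(1)]) auto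
  then show ?thesis
    using assms(2) by (auto simp: differentiable_def)
qed

lemma diff_order_on_SucE:
  assumes "diff_order_on (Suc k) f U" "x \<in> U"
  shows "(f has_derivative frechet_derivative f (at x)) (at x)"
  using assms by (simp add: frechet_derivative_works)

lemma diff_order_on_SucD: "diff_order_on (Suc k) f U \<Longrightarrow> diff_order_on k f U"
proof (induction k arbitrary: f)
  case 0
  then show ?case
    by (auto intro!: continuous_at_imp_continuous_on differentiable_imp_continuous_within)
next
  case (Suc k)
  then show ?case
    by (metis diff_order_on.simps(2))
qed

lemma diff_order_on_const: "diff_order_on k (\<lambda>_. c) U"
proof (induction k arbitrary: c)
  case (Suc k)
  then show ?case by simp
qed simp

lemma diff_order_on_linear:
  assumes "bounded_linear h"
  shows "diff_order_on k h U"
proof (cases k)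
  case 0
  then show ?thesis using assms by (simp add: linear_continuous_on)
next
  case (Suc k')
  have "frechet_derivative h (at x) = h" for x
    using bounded_linear_imp_has_derivative[OF assms] by (metis frechet_derivative_at)
  then show ?thesis
    using assms by (simp add: Suc diff_order_on_const bounded_linear_imp_differentiable)
qed

lemma diff_order_on_compose_linear:
  assumes "open U" "bounded_linear h" "diff_order_on k f U"
  shows "diff_order_on k (\<lambda>x. h (f x)) U"
  using assms(3)
proof (induction k arbitrary: f)
  case 0
  then show ?case
    using assms(2) by (simp add: bounded_linear.continuous_on)
next
  case (Suc k)
  show ?case
  proof (rule diff_order_on_SucI[OF assms(1)])
    show "((\<lambda>x. h (f x)) has_derivative (\<lambda>v. h (frechet_derivative f (at x) v))) (at x)" if "x \<in> U" for x
      using bounded_linear.has_derivative[OF assms(2)] diff_order_on_SucE[OF Suc.prems that] by blast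
    show "diff_order_on k (\<lambda>x. h (frechet_derivative f (at x) v)) U" for v
      using Suc by simp
  qed
qed

lemma diff_order_on_add:
  assumes "open U" "diff_order_on k f U" "diff_order_on k g U"
  shows "diff_order_on k (\<lambda>x. f x + g x) U"
  using assms(2,3)
proof (induction k arbitrary: f g)
  case 0
  then show ?case by (simp add: continuous_on_add)
next
  case (Suc k)
  show ?case
  proof (rule diff_order_on_SucI[OF assms(1)])
    show "((\<lambda>x. f x + g x) has_derivative
        (\<lambda>v. frechet_derivative f (at x) v + frechet_derivative g (at x) v)) (at x)" if "x \<in> U" for x
      using Suc.prems that by (intro has_derivative_add diff_order_on_SucE)
    show "diff_order_on k (\<lambda>x. frechet_derivative f (at x) v + frechet_derivative g (at x) v) U" for v
      using Suc by simp
  qed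
qed

lemma diff_order_on_mult:
  fixes f g :: "'a::real_normed_vector \<Rightarrow> 'b::real_normed_algebra"
  assumes "open U" "diff_order_on k f U" "diff_order_on k g U"
  shows "diff_order_on k (\<lambda>x. f x * g x) U"
  using assms(2,3)
proof (induction k arbitrary: f g)
  case 0
  then show ?case by (simp add: continuous_on_mult)
next
  case (Suc k)
  show ?case
  proof (rule diff_order_on_SucI[OF assms(1)])
    show "((\<lambda>x. f x * g x) has_derivative
        (\<lambda>v. f x * frechet_derivative g (at x) v + frechet_derivative f (at x) v * g x)) (at x)"
      if "x \<in> U" for x
      using Suc.prems that by (intro has_derivative_mult diff_order_on_SucE)
    show "diff_order_on k (\<lambda>x. f x * frechet_derivative g (at x) v + frechet_derivative f (at x) v * g x) U"
      for v
      \<comment> \<open>The undifferentiated factors of the product rule have order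
        \<open>Suc k\<close>; they are lowered to order \<open>k\<close> to fit the induction
        hypothesis.\<close>
      using Suc.prems diff_order_on_SucD[OF Suc.prems(1)] diff_order_on_SucD[OF Suc.prems(2)]
      by (intro diff_order_on_add assms(1) Suc.IH) auto
  qed
qed

lemma diff_order_on_inverse:
  fixes f :: "'a::real_normed_vector \<Rightarrow> 'b::real_normed_div_algebra"
  assumes "open U" "diff_order_on k f U" "\<And>x. x \<in> U \<Longrightarrow> f x \<noteq> 0"
  shows "diff_order_on k (\<lambda>x. inverse (f x)) U"
  using assms(2)
proof (induction k)
  case 0
  then show ?case using assms(3) by (auto intro!: continuous_on_inverse)
next
  case (Suc k)
  show ?case
  proof (rule diff_order_on_SucI[OF assms(1)])
    show "((\<lambda>x. inverse (f x)) has_derivative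
        (\<lambda>v. - (inverse (f x) * frechet_derivative f (at x) v * inverse (f x)))) (at x)"
      if "x \<in> U" for x
      using Suc.prems that assms(3) by (intro Deriv.has_derivative_inverse diff_order_on_SucE)
    show "diff_order_on k (\<lambda>x. - (inverse (f x) * frechet_derivative f (at x) v * inverse (f x))) U"
      for v
      \<comment> \<open>The derivative contains the inverse itself, which has order \<open>k\<close>
        by the induction hypothesis.\<close>
      using Suc.prems Suc.IH[OF diff_order_on_SucD[OF Suc.prems]]
      by (intro diff_order_on_compose_linear[OF assms(1), of uminus] diff_order_on_mult assms(1)
        bounded_linear_minus bounded_linear_ident) auto
  qed
qed

lemma smooth_fun_on_linear: "bounded_linear h \<Longrightarrow> smooth_fun_on h U"
  by (simp add: smooth_fun_on_def diff_order_on_linear)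

lemma smooth_fun_on_compose_linear:
  "open U \<Longrightarrow> bounded_linear h \<Longrightarrow> smooth_fun_on f U \<Longrightarrow> smooth_fun_on (\<lambda>x. h (f x)) U"
  by (simp add: smooth_fun_on_def diff_order_on_compose_linear)

lemma smooth_fun_on_mult:
  fixes f g :: "'a::real_normed_vector \<Rightarrow> 'b::real_normed_algebra"
  shows "open U \<Longrightarrow> smooth_fun_on f U \<Longrightarrow> smooth_fun_on g U \<Longrightarrow> smooth_fun_on (\<lambda>x. f x * g x) U"
  by (simp add: smooth_fun_on_def diff_order_on_mult)

lemma smooth_fun_on_inverse:
  fixes f :: "'a::real_normed_vector \<Rightarrow> 'b::real_normed_div_algebra"
  shows "open U \<Longrightarrow> smooth_fun_on f U \<Longrightarrow> (\<And>x. x \<in> U \<Longrightarrow> f x \<noteq> 0) \<Longrightarrow>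
    smooth_fun_on (\<lambda>x. inverse (f x)) U"
  by (simp add: smooth_fun_on_def diff_order_on_inverse)

lemma diff_order_on_subset: "diff_order_on k f U \<Longrightarrow> V \<subseteq> U \<Longrightarrow> diff_order_on k f V"
  by (induction k arbitrary: f) (auto intro: continuous_on_subset)

lemma smooth_fun_on_subset: "smooth_fun_on f U \<Longrightarrow> V \<subseteq> U \<Longrightarrow> smooth_fun_on f V"
  using diff_order_on_subset unfolding smooth_fun_on_def by blast

lemma smooth_fun_on_differentiable: "smooth_fun_on f U \<Longrightarrow> x \<in> U \<Longrightarrow> f differentiable (at x)"
  unfolding smooth_fun_on_def by (metis diff_order_on.simps(2))

subsection \<open>The pairing and gradients\<close>

text \<open>The vector on the right is \<open>i\<close> times the conjugate transpose of
  \<open>X\<close>. Bilinearity and nondegeneracy of the pairing are thereby inherited from the real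
  inner product.\<close>

lemma pairing_eq_inner:
  fixes X Y :: "'n::finite cmat"
  shows "pairing X Y = Y \<bullet> (\<chi> i j. \<i> * cnj (X $ j $ i))"
proof -
  have "pairing X Y = (\<Sum>i\<in>UNIV. \<Sum>j\<in>UNIV. Im (X $ i $ j * Y $ j $ i))"
    by (simp add: pairing_def trace_def matrix_matrix_mult_def)
  also have "\<dots> = (\<Sum>j\<in>UNIV. \<Sum>i\<in>UNIV. Im (X $ i $ j * Y $ j $ i))"
    by (rule sum.swap)
  finally show ?thesis
    by (simp add: inner_vec_def inner_complex_def algebra_simps)
qed

lemma pairing_commute: "pairing X Y = pairing Y X"
  unfolding pairing_def by (subst trace_mul_sym) (rule refl)

lemma pairing_diff_right: "pairing X (Y - Z) = pairing X Y - pairing X Z"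
  by (simp add: pairing_eq_inner inner_diff_left)

lemma pairing_scaleR_right: "pairing X (c *\<^sub>R Y) = c * pairing X Y"
  by (simp add: pairing_eq_inner)

lemma pairing_sum_right: "pairing X (sum f S) = (\<Sum>s\<in>S. pairing X (f s))"
  by (simp add: pairing_eq_inner inner_sum_left)

text \<open>Cyclicity of the trace. Together with \<open>pairing_mult_right\<close> it moves factors
  from one argument to the other.\<close>

lemma pairing_mult_left: "pairing (A ** X) Y = pairing X (Y ** A)"
  unfolding pairing_def by (metis matrix_mul_assoc trace_mul_sym)

lemma pairing_mult_right: "pairing (X ** A) Y = pairing X (A ** Y)"
  unfolding pairing_def by (metis matrix_mul_assoc)

text \<open>Nondegeneracy of the pairing, which makes gradients unique.\<close>

lemma pairing_left_cancel:
  assumes "\<And>C. pairing X C = pairing Y C"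
  shows "X = Y"
proof -
  have "(\<chi> i j. \<i> * cnj (X $ j $ i)) = (\<chi> i j. \<i> * cnj (Y $ j $ i))"
    using assms unfolding pairing_eq_inner by (metis vector_eq_ldot)
  then show ?thesis
    by (simp add: vec_eq_iff)
qed

text \<open>Riesz representation: \<open>D\<close> is the inner product with
  \<open>adjoint D 1\<close>. Multiplying the conjugate transpose by \<open>i\<close> is an
  involution, so doing this to \<open>adjoint D 1\<close> yields the required
  \<open>X\<close>.\<close>

lemma linear_functional_eq_pairing:
  fixes D :: "'n::finite cmat \<Rightarrow> real"
  assumes "linear D"
  obtains X where "\<And>C. D C = pairing X C"
proof
  let ?w = "adjoint D 1"
  fix C
  have "D C = C \<bullet> ?w"
    using adjoint_works[OF assms, of C 1] by simp
  then show "D C = pairing (\<chi> i j. \<i> * cnj (?w $ j $ i)) C"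
    by (simp add: pairing_eq_inner)
qed

text \<open>The description in \<open>grad\<close> denotes: existence comes from the chain rule and
  the representation of \<open>D\<close>, uniqueness from nondegeneracy. This is the only property
  of gradients used later.\<close>

lemma pairing_grad:
  fixes \<phi> :: "'n::finite cmat \<Rightarrow> real"
  assumes D: "(\<phi> has_derivative D) (at B)"
  shows "pairing (grad \<phi> B) C = D C"
proof -
  have der: "((\<lambda>t. \<phi> (B + t *\<^sub>R C)) has_real_derivative D C) (at 0)" for C
  proof -
    have "((\<lambda>t. B + t *\<^sub>R C) has_derivative (\<lambda>t. t *\<^sub>R C)) (at 0)"
      by (auto intro!: derivative_eq_intros)
    moreover have "(\<phi> has_derivative D) (at (B + 0 *\<^sub>R C))"
      using D by simp
    ultimately have "((\<lambda>t. \<phi> (B + t *\<^sub>R C)) has_derivative (\<lambda>t. D (t *\<^sub>R C))) (at 0)"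
      by (rule has_derivative_compose)
    then show ?thesis
      using D by (simp add: has_field_derivative_def linear_cmul has_derivative_linear mult.commute[of _ "D C"])
  qed
  obtain X where X: "\<And>C. D C = pairing X C"
    using D by (metis has_derivative_linear linear_functional_eq_pairing)
  have "grad \<phi> B = X"
    unfolding grad_def
  proof (rule the_equality)
    show "\<forall>C. ((\<lambda>t. \<phi> (B + t *\<^sub>R C)) has_real_derivative pairing X C) (at 0)"
      using der X by simp
  next
    fix Y
    assume "\<forall>C. ((\<lambda>t. \<phi> (B + t *\<^sub>R C)) has_real_derivative pairing Y C) (at 0)"
    then show "Y = X"
      using der X by (metis DERIV_unique pairing_left_cancel)
  qed
  then show ?thesis
    using X by simp
qed

subsection \<open>Multiplicativity of the Gelfand--Dikij bracket\<close>

text \<open>Above the diagonal the skew part carries all of \<open>X\<close>; this fixes it below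
  the diagonal, and the diagonal splits into real and imaginary parts. The equivalence gives
  existence and uniqueness at once, as the descriptions in \<open>proj_l\<close> and
  \<open>proj_a\<close> require.\<close>

lemma lower_skew_decomposition:
  fixes X Y :: "'n::{finite,linorder} cmat"
  shows "Y \<in> lower_real_diag \<and> X - Y \<in> skew_hermitian \<longleftrightarrow>
    Y = (\<chi> i j. if i < j then 0 else if i = j then of_real (Re (X $ i $ i))
      else X $ i $ j + cnj (X $ j $ i))" (is "?lhs \<longleftrightarrow> Y = ?P")
proof
  show "?lhs" if "Y = ?P"
    unfolding that
    by (auto simp: lower_real_diag_def skew_hermitian_def vec_eq_iff complex_eq_iff)
next
  assume Y: ?lhs
  have skew: "X $ i $ j - Y $ i $ j = - (cnj (X $ j $ i) - cnj (Y $ j $ i))" for i j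
    using Y by (simp add: skew_hermitian_def vec_eq_iff)
  have low: "Y $ i $ j = 0" if "i < j" for i j
    using Y that by (simp add: lower_real_diag_def)
  have diag: "Im (Y $ i $ i) = 0" for i
    using Y by (auto simp: lower_real_diag_def complex_is_Real_iff)
  have "Y $ i $ j = ?P $ i $ j" for i j
  proof (cases i j rule: linorder_cases)
    case less
    then show ?thesis by (simp add: low)
  next
    case equal
    then show ?thesis
      using skew[of i i] diag[of i] by (simp add: complex_eq_iff)
  next
    case greater
    then have "\<not> i < j" "i \<noteq> j" by auto
    then show ?thesis
      using skew[of i j] low[OF greater] by (simp add: algebra_simps)
  qed
  then show "Y = ?P" by (simp add: vec_eq_iff)
qed

text \<open>The two projections add up to the identity, so \<open>R_op\<close> is twice
  \<open>proj_l\<close> minus the identity.\<close>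

lemma R_op_nth:
  "R_op X $ i $ j = (if i < j then - X $ i $ j else if i = j then cnj (X $ i $ i)
     else X $ i $ j + 2 * cnj (X $ j $ i))"
proof -
  let ?P = "\<chi> i j. if i < j then 0 else if i = j then of_real (Re (X $ i $ i))
    else X $ i $ j + cnj (X $ j $ i)"
  have "proj_l X = ?P"
    unfolding proj_l_def lower_skew_decomposition by simp
  moreover have "proj_a X = X - ?P"
    unfolding proj_a_def
  proof (rule the_equality)
    show "X - ?P \<in> skew_hermitian \<and> X - (X - ?P) \<in> lower_real_diag"
      using lower_skew_decomposition[of ?P X] by simp
    show "Y = X - ?P" if "Y \<in> skew_hermitian \<and> X - Y \<in> lower_real_diag" for Y
      using that lower_skew_decomposition[of "X - Y" X] by (simp add: algebra_simps)
  qed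
  ultimately show ?thesis
    by (simp add: R_op_def complex_eq_iff)
qed

text \<open>Twice the vector field \<open>V\<^sub>X\<close> of the introductory text, named after
  the Sklyanin bracket.\<close>

definition sklyanin :: "'n::{finite,linorder} cmat \<Rightarrow> 'n cmat \<Rightarrow> 'n cmat" where
  "sklyanin X g = g ** R_op (X ** g) - R_op (g ** X) ** g"

text \<open>Moving \<open>B\<close> across the pairing isolates the gradient of
  \<open>\<psi>\<close>.\<close>

lemma gd_bracket_eq_sklyanin:
  "gd_bracket \<phi> \<psi> B = 1/2 * pairing (grad \<psi> B) (sklyanin (grad \<phi> B) B)"
proof -
  let ?X = "grad \<phi> B" and ?Y = "grad \<psi> B"
  have "pairing (R_op (?X ** B)) (?Y ** B) = pairing ?Y (B ** R_op (?X ** B))"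
    by (metis pairing_commute pairing_mult_right)
  moreover have "pairing (R_op (B ** ?X)) (B ** ?Y) = pairing ?Y (R_op (B ** ?X) ** B)"
    by (metis pairing_commute pairing_mult_left)
  ultimately show ?thesis
    by (simp add: gd_bracket_def Let_def sklyanin_def pairing_diff_right algebra_simps)
qed

lemma bounded_bilinear_matrix_mult:
  "bounded_bilinear ((**) :: 'n::finite cmat \<Rightarrow> 'n cmat \<Rightarrow> 'n cmat)"
proof -
  have "A ** (B + C) = A ** B + A ** C" "(A + B) ** C = A ** C + B ** C" for A B C :: "'n cmat"
    by (simp_all add: vec_eq_iff matrix_matrix_mult_def distrib_left distrib_right sum.distrib)
  moreover have "A ** (c *\<^sub>R B) = c *\<^sub>R (A ** B)" "(c *\<^sub>R A) ** B = c *\<^sub>R (A ** B)" for A B :: "'n cmat" and c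
    by (simp_all add: vec_eq_iff matrix_matrix_mult_def flip: scaleR_right.sum)
  ultimately have "bilinear ((**) :: 'n cmat \<Rightarrow> 'n cmat \<Rightarrow> 'n cmat)"
    unfolding bilinear_def by (intro conjI allI linearI)
  then show ?thesis
    by (simp add: bilinear_conv_bounded_bilinear)
qed

text \<open>Supplies the rules for differences, sums and scalars in matrix products, and the product
  rule for derivatives.\<close>

interpretation matrix_mult: bounded_bilinear "(**) :: 'n::finite cmat \<Rightarrow> 'n cmat \<Rightarrow> 'n cmat"
  by (rule bounded_bilinear_matrix_mult)

text \<open>Both summands on the right contain \<open>A ** R_op (B ** X ** A) ** B\<close>, with
  opposite signs; what is left after cancellation is the left-hand side.\<close>

lemma sklyanin_mult:
  "sklyanin X (A ** B) = A ** sklyanin (X ** A) B + sklyanin (B ** X) A ** B"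
  by (simp add: sklyanin_def matrix_mult.diff_left matrix_mult.diff_right matrix_mul_assoc)

subsection \<open>The bracket at a single block\<close>

text \<open>The entry \<open>d\<close> fills the rest of the diagonal: \<open>d = 1\<close> for
  factors of a CMV matrix, \<open>d = 0\<close> for their derivatives.\<close>

definition block :: "'n::finite \<Rightarrow> 'n \<Rightarrow> complex \<Rightarrow> complex \<Rightarrow> complex \<Rightarrow> complex \<Rightarrow> complex \<Rightarrow> 'n cmat"
  where
  "block p q w x y z d = (\<chi> i j.
    if i = p \<and> j = p then w else if i = p \<and> j = q then x
    else if i = q \<and> j = p then y else if i = q \<and> j = q then z
    else if i = j then d else 0)"

lemma block_nth:
  "block p q w x y z d $ i $ j =
    (if i = p \<and> j = p then w else if i = p \<and> j = q then x
     else if i = q \<and> j = p then y else if i = q \<and> j = q then z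
     else if i = j then d else 0)"
  by (simp add: block_def)

lemma block_nth_outside:
  "i \<notin> {p, q} \<or> j \<notin> {p, q} \<Longrightarrow> block p q w x y z 0 $ i $ j = 0"
  by (elim disjE) (simp_all add: block_nth)

section \<open>Products and pairings with a single block\<close>

lemma sum_two_points:
  fixes f :: "'n::finite \<Rightarrow> 'a::comm_monoid_add"
  assumes "p \<noteq> q" and "\<And>l. l \<noteq> p \<Longrightarrow> l \<noteq> q \<Longrightarrow> f l = 0"
  shows "sum f UNIV = f p + f q"
proof -
  have "sum f UNIV = sum f {p, q}"
    using assms by (intro sum.mono_neutral_right) auto
  then show ?thesis
    using assms by simp
qed

lemma sum_one_point:
  fixes f :: "'n::finite \<Rightarrow> 'a::comm_monoid_add"
  assumes "\<And>l. l \<noteq> p \<Longrightarrow> f l = 0"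
  shows "sum f UNIV = f p"
proof -
  have "sum f UNIV = sum f {p}"
    using assms by (intro sum.mono_neutral_right) auto
  then show ?thesis
    using assms by simp
qed

lemma mult_block_nth:
  assumes "p \<noteq> q"
  shows "(A ** block p q w x y z d) $ i $ j =
    (if j = p then A $ i $ p * w + A $ i $ q * y
     else if j = q then A $ i $ p * x + A $ i $ q * z else A $ i $ j * d)"
proof (cases "j = p \<or> j = q")
  case True
  then have "(A ** block p q w x y z d) $ i $ j =
    A $ i $ p * block p q w x y z d $ p $ j + A $ i $ q * block p q w x y z d $ q $ j"
    unfolding matrix_matrix_mult_def
    by (simp, intro sum_two_points) (use assms in \<open>auto simp: block_nth\<close>)
  then show ?thesis
    using True assms by (auto simp: block_nth)
next
  case False
  then have "(A ** block p q w x y z d) $ i $ j = A $ i $ j * block p q w x y z d $ j $ j"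
    unfolding matrix_matrix_mult_def
    by (simp, intro sum_one_point) (use assms in \<open>auto simp: block_nth\<close>)
  then show ?thesis
    using False assms by (auto simp: block_nth)
qed

lemma block_mult_nth:
  assumes "p \<noteq> q"
  shows "(block p q w x y z d ** A) $ i $ j =
    (if i = p then w * A $ p $ j + x * A $ q $ j
     else if i = q then y * A $ p $ j + z * A $ q $ j else d * A $ i $ j)"
proof (cases "i = p \<or> i = q")
  case True
  then have "(block p q w x y z d ** A) $ i $ j =
    block p q w x y z d $ i $ p * A $ p $ j + block p q w x y z d $ i $ q * A $ q $ j"
    unfolding matrix_matrix_mult_def
    by (simp, intro sum_two_points) (use assms in \<open>auto simp: block_nth\<close>)
  then show ?thesis
    using True assms by (auto simp: block_nth)
next
  case False
  then have "(block p q w x y z d ** A) $ i $ j = block p q w x y z d $ i $ i * A $ i $ j"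
    unfolding matrix_matrix_mult_def
    by (simp, intro sum_one_point) (use assms in \<open>auto simp: block_nth\<close>)
  then show ?thesis
    using False assms by (auto simp: block_nth)
qed

lemma pairing_block:
  assumes "p \<noteq> q"
  shows "pairing X (block p q w x y z 0) =
    Im (X $ p $ p * w + X $ p $ q * y + X $ q $ p * x + X $ q $ q * z)"
proof -
  have "trace (X ** block p q w x y z 0) =
    (X ** block p q w x y z 0) $ p $ p + (X ** block p q w x y z 0) $ q $ q"
    unfolding trace_def
    by (intro sum_two_points) (use assms in \<open>auto simp: mult_block_nth\<close>)
  then show ?thesis
    using assms by (simp add: pairing_def mult_block_nth)
qed

text \<open>No index lies between \<open>p\<close> and \<open>q\<close>, so every other index is on
  the same side of both, and \<open>R_op\<close> treats its entries with \<open>p\<close> and with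
  \<open>q\<close> by the same rule. Above the diagonal the two terms of \<open>sklyanin\<close>
  then agree at once; below it the conjugated terms agree because the block is unitary.\<close>

lemma sklyanin_block_outside:
  fixes p q :: "'n::{finite,linorder}" and X :: "'n cmat"
  assumes pq: "p < q" "\<And>i. i \<noteq> p \<Longrightarrow> i \<noteq> q \<Longrightarrow> i < p \<longleftrightarrow> i < q"
    and unit: "cnj a * a + of_real r * of_real r = 1"
    and out: "i \<notin> {p, q} \<or> j \<notin> {p, q}"
  shows "sklyanin X (block p q (cnj a) (of_real r) (of_real r) (- a) 1) $ i $ j = 0"
proof -
  have ne: "p \<noteq> q" "q \<noteq> p" "\<not> q < p" using pq by auto
  note nth = sklyanin_def mult_block_nth[OF ne(1)] block_mult_nth[OF ne(1)] R_op_nth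
  \<comment> \<open>Unitarity in the form in which it is met below: the factor 2 and the conjugated
    entry \<open>x\<close> come from the lower triangle in \<open>R_op_nth\<close>.\<close>
  have unit': "2 * x * (cnj a * a) + 2 * x * (of_real r * of_real r) = 2 * x" for x
    using unit by (metis distrib_left mult.right_neutral)
  let ?below = "\<lambda>l. l < p \<and> l < q \<and> \<not> p < l \<and> \<not> q < l \<and> l \<noteq> p \<and> l \<noteq> q \<and> p \<noteq> l \<and> q \<noteq> l"
  let ?above = "\<lambda>l. p < l \<and> q < l \<and> \<not> l < p \<and> \<not> l < q \<and> l \<noteq> p \<and> l \<noteq> q \<and> p \<noteq> l \<and> q \<noteq> l"
  have sides: "?below l \<or> ?above l" if "l \<notin> {p, q}" for l
    using pq(2)[of l] that by auto
  consider "i \<notin> {p, q}" "j \<notin> {p, q}" | (ip) "i = p" "j \<notin> {p, q}" | (iq) "i = q" "j \<notin> {p, q}"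
    | (jp) "j = p" "i \<notin> {p, q}" | (jq) "j = q" "i \<notin> {p, q}"
    using out by blast
  then show ?thesis
  proof cases
    case 1
    then show ?thesis by (simp add: nth)
  next
    case ip
    from sides[OF ip(2)] show ?thesis
      by (rule disjE)
        (use ip(1) ne pq(1) unit'[of "cnj (X $ j $ i)"] in \<open>simp_all add: nth algebra_simps\<close>)
  next
    case iq
    from sides[OF iq(2)] show ?thesis
      by (rule disjE)
        (use iq(1) ne pq(1) unit'[of "cnj (X $ j $ i)"] in \<open>simp_all add: nth algebra_simps\<close>)
  next
    case jp
    from sides[OF jp(2)] show ?thesis
      by (rule disjE)
        (use jp(1) ne pq(1) unit'[of "cnj (X $ j $ i)"] in \<open>simp_all add: nth algebra_simps\<close>)
  next
    case jq
    from sides[OF jq(2)] show ?thesis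
      by (rule disjE)
        (use jq(1) ne pq(1) unit'[of "cnj (X $ j $ i)"] in \<open>simp_all add: nth algebra_simps\<close>)
  qed
qed

text \<open>A computation of the four entries in the block. \<open>Eu\<close> and \<open>Ev\<close>
  are the derivatives of the block along the real and imaginary part of \<open>a\<close>, where
  \<open>r\<close> varies as the square root of \<open>1 - |a|^2\<close>; thus the field is tangent
  to the family of blocks.\<close>

lemma sklyanin_block:
  fixes p q :: "'n::{finite,linorder}" and X :: "'n cmat"
  assumes pq: "p < q" "\<And>i. i \<noteq> p \<Longrightarrow> i \<noteq> q \<Longrightarrow> i < p \<longleftrightarrow> i < q"
    and r: "r > 0" "r\<^sup>2 = 1 - (cmod a)\<^sup>2"
  defines "Eu \<equiv> block p q 1 (of_real (- Re a / r)) (of_real (- Re a / r)) (- 1) 0"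
    and "Ev \<equiv> block p q (- \<i>) (of_real (- Im a / r)) (of_real (- Im a / r)) (- \<i>) 0"
  shows "(1/2) *\<^sub>R sklyanin X (block p q (cnj a) (of_real r) (of_real r) (- a) 1) =
    r\<^sup>2 *\<^sub>R (pairing X Eu *\<^sub>R Ev - pairing X Ev *\<^sub>R Eu)"
    (is "_ *\<^sub>R sklyanin X ?E = ?V")
proof -
  have ne: "p \<noteq> q" "q \<noteq> p" "\<not> q < p" using pq by auto
  note nth = sklyanin_def mult_block_nth[OF ne(1)] block_mult_nth[OF ne(1)] R_op_nth
  have "Re a * Re a + Im a * Im a + r * r = 1"
    using r(2) by (simp add: power2_eq_square cmod_power2 cmod_def)
  then have unit: "cnj a * a + of_real r * of_real r = 1"
    by (simp add: complex_eq_iff algebra_simps)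
  \<comment> \<open>The two pairings multiplied by \<open>r\<^sup>2\<close>, which clears the
    denominators of \<open>Eu\<close> and \<open>Ev\<close>.\<close>
  define eu where "eu = r * r * (Im (X $ p $ p) - Im (X $ q $ q)) - r * Re a * (Im (X $ p $ q) + Im (X $ q $ p))"
  define ev where "ev = - r * r * (Re (X $ p $ p) + Re (X $ q $ q)) - r * Im a * (Im (X $ p $ q) + Im (X $ q $ p))"
  have eu: "r\<^sup>2 * pairing X Eu = eu"
    using r(1) unfolding Eu_def pairing_block[OF ne(1)]
    by (simp add: eu_def power2_eq_square algebra_simps)
  have ev: "r\<^sup>2 * pairing X Ev = ev"
    using r(1) unfolding Ev_def pairing_block[OF ne(1)]
    by (simp add: ev_def power2_eq_square algebra_simps)
  have V: "?V = eu *\<^sub>R Ev - ev *\<^sub>R Eu"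
    by (simp add: eu[symmetric] ev[symmetric] scaleR_diff_right)
  \<comment> \<open>In the off-diagonal coefficient the terms with \<open>Re a * Im a\<close>
    cancel, and one factor \<open>r\<close> absorbs the division.\<close>
  have off: "eu * (- Im a / r) - ev * (- Re a / r) =
      - r * (Im a * (Im (X $ p $ p) - Im (X $ q $ q)) + Re a * (Re (X $ p $ p) + Re (X $ q $ q)))"
    using r(1) by (simp add: eu_def ev_def field_simps)
  have "((1/2) *\<^sub>R sklyanin X ?E) $ i $ j = ?V $ i $ j" for i j
  proof (cases "i \<in> {p, q} \<and> j \<in> {p, q}")
    case False
    then have "sklyanin X ?E $ i $ j = 0"
      by (intro sklyanin_block_outside[OF pq unit]) auto
    moreover have "Eu $ i $ j = 0" "Ev $ i $ j = 0"
      unfolding Eu_def Ev_def using False by (blast intro: block_nth_outside)+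
    ultimately show ?thesis
      by simp
  next
    case True
    have pp: "?V $ p $ p = Complex (- ev) (- eu)"
      unfolding V by (simp add: Eu_def Ev_def block_nth complex_eq_iff)
    have qq: "?V $ q $ q = Complex ev (- eu)"
      using ne unfolding V by (simp add: Eu_def Ev_def block_nth complex_eq_iff)
    have "?V $ p $ q = of_real (eu * (- Im a / r) - ev * (- Re a / r))"
      "?V $ q $ p = of_real (eu * (- Im a / r) - ev * (- Re a / r))"
      using ne unfolding V by (simp_all add: Eu_def Ev_def block_nth complex_eq_iff)
    note V_nth = pp qq this[unfolded off]
    from True consider "i = p" "j = p" | "i = p" "j = q" | "i = q" "j = p" | "i = q" "j = q" by blast
    then show ?thesis
    proof cases
      case 1
      show ?thesis
        unfolding 1 V_nth using ne pq(1)
        by (simp add: nth complex_eq_iff eu_def ev_def) (simp add: algebra_simps)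
    next
      case 2
      show ?thesis
        unfolding 2 V_nth using ne pq(1)
        by (simp add: nth complex_eq_iff eu_def ev_def) (simp add: algebra_simps)
    next
      case 3
      show ?thesis
        unfolding 3 V_nth using ne pq(1)
        by (simp add: nth complex_eq_iff eu_def ev_def) (simp add: algebra_simps)
    next
      case 4
      show ?thesis
        unfolding 4 V_nth using ne pq(1)
        by (simp add: nth complex_eq_iff eu_def ev_def) (simp add: algebra_simps)
    qed
  qed
  then show ?thesis by (simp add: vec_eq_iff)
qed

subsection \<open>Factorization of CMV matrices\<close>

lemma idx_less_iff: "idx i < idx j \<longleftrightarrow> i < j"
proof (cases i j rule: linorder_cases)
  case less
  then show ?thesis
    by (auto simp: idx_def intro!: psubset_card_mono)
next
  case greater
  then have "idx j < idx i"
    by (auto simp: idx_def intro!: psubset_card_mono)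
  then show ?thesis using greater by auto
qed auto

lemma idx_eq_iff [simp]: "idx i = idx j \<longleftrightarrow> i = j"
  using idx_less_iff[of i j] idx_less_iff[of j i] by (metis less_irrefl linorder_less_linear)

lemma idx_less_card: "idx (i :: 'n::{finite,linorder}) < CARD('n)"
  unfolding idx_def by (rule psubset_card_mono) auto

lemma obtain_idx:
  assumes "k < CARD('n::{finite,linorder})"
  obtains i :: "'n::{finite,linorder}" where "idx i = k"
proof -
  have "range (idx :: 'n \<Rightarrow> nat) = {..<CARD('n)}"
    by (rule card_subset_eq) (auto simp: idx_less_card card_image inj_on_def)
  then show ?thesis using assms that by (metis imageE lessThan_iff)
qed

text \<open>For a unitary diagonal matrix \<open>D\<close> the products
  \<open>D ** R_op (X ** D)\<close> and \<open>R_op (D ** X) ** D\<close> agree entry by entry: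
  conjugated entries meet a phase and its conjugate. This handles the block of the last
  coefficient.\<close>

lemma sklyanin_diagonal:
  assumes "\<And>i. cmod (d i) = 1"
  shows "sklyanin X (\<chi> i j. if i = j then d i else 0) = 0"
proof -
  let ?D = "\<chi> i j. if i = j then d i else 0"
  have 1: "(A ** ?D) $ i $ j = A $ i $ j * d j" for A :: "'a cmat" and i j
    unfolding matrix_matrix_mult_def
    by (simp, subst sum_one_point[where p = j]) auto
  have 2: "(?D ** A) $ i $ j = d i * A $ i $ j" for A :: "'a cmat" and i j
    unfolding matrix_matrix_mult_def
    by (simp, subst sum_one_point[where p = i]) auto
  have unit: "d i * cnj (d i) = 1" for i
    using assms[of i] by (metis complex_norm_square of_real_1 one_power2)
  have "sklyanin X ?D $ i $ j = 0" for i j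
    using unit[of i] unit[of j]
    by (simp add: sklyanin_def 1 2 R_op_nth algebra_simps)
  then show ?thesis by (simp add: vec_eq_iff)
qed

text \<open>In the Leibniz sum only the identity and the transposition of \<open>p\<close> and
  \<open>q\<close> can avoid the zero entries.\<close>

lemma det_block:
  assumes "p \<noteq> q"
  shows "det (block p q w x y z 1) = w * z - x * y"
proof -
  let ?E = "block p q w x y z 1"
  let ?t = "\<lambda>s. of_int (sign s) * (\<Prod>i\<in>UNIV. ?E $ i $ s i)"
  let ?sw = "Transposition.transpose p q"
  have "det ?E = sum ?t {s. s permutes UNIV}"
    by (simp add: det_def)
  also have "\<dots> = sum ?t {id, ?sw}"
  proof (rule sum.mono_neutral_right)
    show "\<forall>s\<in>{s. s permutes UNIV} - {id, ?sw}. ?t s = 0"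
    proof
      fix s assume s: "s \<in> {s. s permutes UNIV} - {id, ?sw}"
      then have inj: "inj s" by (auto intro: permutes_inj)
      have "\<exists>i. ?E $ i $ s i = 0"
      proof (rule ccontr)
        assume "\<not> ?thesis"
        then have nz: "?E $ i $ s i \<noteq> 0" for i by auto
        have out: "s i = i" if "i \<noteq> p" "i \<noteq> q" for i
          using nz[of i] that by (auto simp: block_nth split: if_splits)
        have "s p \<in> {p, q}" "s q \<in> {p, q}"
          using nz[of p] nz[of q] assms by (auto simp: block_nth split: if_splits)
        moreover have "s p \<noteq> s q" using inj assms by (auto dest: injD)
        ultimately consider "s p = p" "s q = q" | "s p = q" "s q = p" by auto
        then have "s = id \<or> s = ?sw"
        proof cases
          case 1
          then have "s i = i" for i using out by metis
          then show ?thesis by (simp add: fun_eq_iff)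
        next
          case 2
          then have "s i = ?sw i" for i using out by (simp add: Transposition.transpose_def)
          then show ?thesis by (simp add: fun_eq_iff)
        qed
        then show False using s by auto
      qed
      then show "?t s = 0" by auto
    qed
  qed (auto simp: permutes_id permutes_swap_id)
  also have "\<dots> = ?t id + ?t ?sw"
  proof -
    have "id \<noteq> ?sw"
      using assms by (metis id_apply transpose_apply_first)
    then show ?thesis by simp
  qed
  also have "\<dots> = w * z - x * y"
  proof -
    have prod: "prod f UNIV = f p * f q" if "\<And>i. i \<noteq> p \<Longrightarrow> i \<noteq> q \<Longrightarrow> f i = 1" for f :: "'a \<Rightarrow> complex"
    proof -
      have "prod f UNIV = prod f {p, q}"
        using that by (intro prod.mono_neutral_right) auto
      then show ?thesis using assms by simp
    qed
    show ?thesis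
      using assms by (subst (1 2) prod)
        (auto simp: block_nth sign_swap_id Transposition.transpose_def sign_id)
  qed
  finally show ?thesis .
qed

text \<open>Rows and columns beyond the matrix are cut off: \<open>k = n - 1\<close> leaves the
  \<open>1 \<times> 1\<close> block, and a larger \<open>k\<close> gives the identity, so that
  \<open>k\<close> can range over all numbers.\<close>

definition Xi_factor :: "nat \<Rightarrow> (nat \<Rightarrow> complex) \<Rightarrow> 'n::{finite,linorder} cmat" where
  "Xi_factor k \<beta> = (\<chi> i j.
    if idx i \<in> {k, Suc k} \<and> idx j \<in> {k, Suc k} then Xi \<beta> k (idx i - k) (idx j - k)
    else if i = j then 1 else 0)"

lemma Xi_factor_eq_block:
  assumes "idx p = k" "idx q = Suc k"
  shows "Xi_factor k \<beta> = block p q (cnj (\<beta> k)) (of_real (rho \<beta> k)) (of_real (rho \<beta> k)) (- \<beta> k) 1"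
proof -
  have p: "idx i = k \<longleftrightarrow> i = p" for i using assms by (metis idx_eq_iff)
  have q: "idx i = Suc k \<longleftrightarrow> i = q" for i using assms by (metis idx_eq_iff)
  have ne: "p \<noteq> q" "q \<noteq> p" using assms by auto
  have "Xi_factor k \<beta> $ i $ j =
    block p q (cnj (\<beta> k)) (of_real (rho \<beta> k)) (of_real (rho \<beta> k)) (- \<beta> k) 1 $ i $ j" for i j
  proof (cases "i \<in> {p, q} \<and> j \<in> {p, q}")
    case True
    then show ?thesis
      using ne by (elim conjE insertE emptyE) (simp_all add: Xi_factor_def block_nth assms Xi_def)
  next
    case False
    then have "i = p \<and> j \<noteq> p \<and> j \<noteq> q \<or> i = q \<and> j \<noteq> p \<and> j \<noteq> q \<or> i \<noteq> p \<and> i \<noteq> q" by blast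
    then show ?thesis
      using ne by (elim conjE disjE) (simp_all add: Xi_factor_def block_nth p q)
  qed
  then show ?thesis by (simp add: vec_eq_iff)
qed

lemma Xi_factor_eq_diagonal:
  assumes "CARD('n::{finite,linorder}) - 1 \<le> k"
  shows "(Xi_factor k \<beta> :: 'n cmat) =
    (\<chi> i j. if i = j then (if idx i = CARD('n) - 1 \<and> k = CARD('n) - 1 then cnj (\<beta> k) else 1) else 0)"
proof -
  have 1: "idx i \<noteq> Suc k" "idx i = k \<Longrightarrow> k = CARD('n) - 1" for i :: 'n
    using idx_less_card[of i] assms by linarith+
  have "(Xi_factor k \<beta> :: 'n cmat) $ i $ j =
    (if i = j then (if idx i = CARD('n) - 1 \<and> k = CARD('n) - 1 then cnj (\<beta> k) else 1) else 0)" for i j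
  proof (cases "i = j")
    case True
    show ?thesis
      using 1[of j] unfolding True by (cases "idx j = k") (auto simp: Xi_factor_def Xi_def)
  next
    case False
    then have "idx i \<noteq> k \<or> idx j \<noteq> k" by (metis idx_eq_iff)
    with False show ?thesis using 1[of i] 1[of j] by (auto simp: Xi_factor_def)
  qed
  then show ?thesis by (simp add: vec_eq_iff)
qed

text \<open>The value \<open>- |\<beta>\<^sub>k|\<^sup>2 - \<rho>\<^sub>k\<^sup>2\<close> does not
  vary with the coefficient.\<close>

lemma det_Xi_factor:
  assumes "verblunsky CARD('n) \<beta>" "k < CARD('n::{finite,linorder}) - 1"
  shows "det (Xi_factor k \<beta> :: 'n cmat) = - 1"
proof -
  have "k < CARD('n)" "Suc k < CARD('n)" using assms by linarith+
  then obtain p q :: 'n where p: "idx p = k" and q: "idx q = Suc k" by (metis obtain_idx)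
  have "p \<noteq> q" using p q by auto
  moreover have "cmod (\<beta> k) < 1" using assms by (simp add: verblunsky_def)
  then have "(rho \<beta> k)\<^sup>2 = 1 - (cmod (\<beta> k))\<^sup>2"
    by (simp add: rho_def power_le_one)
  then have "of_real (rho \<beta> k) * of_real (rho \<beta> k) = 1 - \<beta> k * cnj (\<beta> k)"
    by (metis complex_norm_square of_real_1 of_real_diff of_real_mult power2_eq_square)
  ultimately show ?thesis
    by (simp add: Xi_factor_eq_block[OF p q] det_block)
qed

text \<open>Since \<open>A\<close> is the identity on the rows and columns \<open>k\<close> and
  \<open>k + 1\<close>, multiplication by the factor merely inserts its block.\<close>

lemma matrix_mult_Xi_factor_nth:
  fixes A :: "'n::{finite,linorder} cmat"
  assumes "\<And>i j. idx i \<in> {k, Suc k} \<or> idx j \<in> {k, Suc k} \<Longrightarrow> A $ i $ j = (if i = j then 1 else 0)"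
  shows "(A ** Xi_factor k \<beta>) $ i $ j =
    (if idx i \<in> {k, Suc k} \<and> idx j \<in> {k, Suc k} then Xi \<beta> k (idx i - k) (idx j - k)
     else A $ i $ j)"
proof -
  let ?E = "Xi_factor k \<beta> :: 'n cmat"
  have prod: "(A ** ?E) $ i $ j = (\<Sum>l\<in>UNIV. A $ i $ l * ?E $ l $ j)"
    by (simp add: matrix_matrix_mult_def)
  consider "idx j \<notin> {k, Suc k}" | "idx i \<in> {k, Suc k}" "idx j \<in> {k, Suc k}"
    | "idx i \<notin> {k, Suc k}" "idx j \<in> {k, Suc k}" by blast
  then show ?thesis
  proof cases
    case 1
    then show ?thesis
      unfolding prod by (subst sum_one_point[where p = j]) (auto simp: Xi_factor_def)
  next
    case 2
    then show ?thesis
      unfolding prod by (subst sum_one_point[where p = i]) (auto simp: Xi_factor_def assms)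
  next
    case 3
    have "A $ i $ l * ?E $ l $ j = 0" for l
      using 3 assms[of i l] by (auto simp: Xi_factor_def)
    then have "(A ** ?E) $ i $ j = 0"
      unfolding prod by (intro sum.neutral) blast
    moreover have "A $ i $ j = 0" using 3 assms[of i j] by auto
    ultimately show ?thesis
      using 3 by auto
  qed
qed

text \<open>The first \<open>m\<close> blocks are in place and the rest is the identity, so each
  step appends one factor.\<close>

definition L_partial :: "nat \<Rightarrow> (nat \<Rightarrow> complex) \<Rightarrow> 'n::{finite,linorder} cmat" where
  "L_partial m \<beta> = (\<chi> i j. if idx i div 2 < m then L_entry \<beta> (idx i) (idx j) else if i = j then 1 else 0)"

text \<open>The leading block \<open>[1]\<close> has number 0 and already agrees with the identity.
  Hence \<open>m\<close> counts the blocks of odd index, and \<open>\<le>\<close> replaces the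
  \<open><\<close> of \<open>L_partial\<close>.\<close>

definition M_partial :: "nat \<Rightarrow> (nat \<Rightarrow> complex) \<Rightarrow> 'n::{finite,linorder} cmat" where
  "M_partial m \<beta> = (\<chi> i j. if Suc (idx i) div 2 \<le> m then M_entry \<beta> (idx i) (idx j) else if i = j then 1 else 0)"

lemma L_partial_0: "L_partial 0 \<beta> = mat 1"
  by (simp add: L_partial_def mat_def vec_eq_iff)

lemma M_partial_0: "M_partial 0 \<beta> = mat 1"
proof -
  have "Suc n div 2 = 0 \<longleftrightarrow> n = 0" "0 = Suc n div 2 \<longleftrightarrow> n = 0" for n by presburger+
  then show ?thesis
    by (auto simp: M_partial_def mat_def vec_eq_iff M_entry_def simp flip: idx_eq_iff)
qed

lemma L_partial_Suc:
  "(L_partial (Suc m) \<beta> :: 'n::{finite,linorder} cmat) = L_partial m \<beta> ** Xi_factor (2 * m) \<beta>"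
proof -
  have in_block: "n \<in> {2 * m, Suc (2 * m)} \<longleftrightarrow> n div 2 = m" for n by auto
  have offset: "n - 2 * m = n mod 2" if "n div 2 = m" for n using that by presburger
  have outside: "(L_partial m \<beta> :: 'n cmat) $ i $ j = (if i = j then 1 else 0)"
    if "idx i \<in> {2 * m, Suc (2 * m)} \<or> idx j \<in> {2 * m, Suc (2 * m)}" for i j :: 'n
    using that unfolding in_block by (auto simp: L_partial_def L_entry_def)
  have "L_partial (Suc m) \<beta> $ i $ j = (L_partial m \<beta> ** Xi_factor (2 * m) \<beta>) $ i $ j" for i j :: 'n
    by (subst matrix_mult_Xi_factor_nth, erule outside, unfold in_block)
      (auto simp: L_partial_def L_entry_def less_Suc_eq offset)
  then show ?thesis by (simp add: vec_eq_iff)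
qed

lemma M_partial_Suc:
  "(M_partial (Suc m) \<beta> :: 'n::{finite,linorder} cmat) = M_partial m \<beta> ** Xi_factor (Suc (2 * m)) \<beta>"
proof -
  have in_block: "n \<in> {Suc (2 * m), Suc (Suc (2 * m))} \<longleftrightarrow> Suc n div 2 = Suc m" for n by auto
  have offset: "n - Suc (2 * m) = Suc n mod 2" if "Suc n div 2 = Suc m" for n using that by presburger
  have outside: "(M_partial m \<beta> :: 'n cmat) $ i $ j = (if i = j then 1 else 0)"
    if "idx i \<in> {Suc (2 * m), Suc (Suc (2 * m))} \<or> idx j \<in> {Suc (2 * m), Suc (Suc (2 * m))}" for i j :: 'n
    using that unfolding in_block by (auto simp: M_partial_def M_entry_def)
  have "M_partial (Suc m) \<beta> $ i $ j = (M_partial m \<beta> ** Xi_factor (Suc (2 * m)) \<beta>) $ i $ j" for i j :: 'n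
    by (subst matrix_mult_Xi_factor_nth, erule outside, unfold in_block)
      (auto simp: M_partial_def M_entry_def le_Suc_eq offset)
  then show ?thesis by (simp add: vec_eq_iff)
qed

text \<open>All block numbers are below \<open>n\<close>, so \<open>n\<close> steps reach every row;
  factors lying outside the matrix are identities.\<close>

lemma L_matrix_eq_partial: "(L_matrix \<beta> :: 'n::{finite,linorder} cmat) = L_partial CARD('n) \<beta>"
proof -
  have "idx i div 2 < CARD('n)" for i :: 'n using idx_less_card[of i] by linarith
  then show ?thesis by (simp add: L_matrix_def L_partial_def)
qed

lemma M_matrix_eq_partial: "(M_matrix \<beta> :: 'n::{finite,linorder} cmat) = M_partial CARD('n) \<beta>"
proof -
  have "Suc (idx i) div 2 \<le> CARD('n)" for i :: 'n using idx_less_card[of i] by linarith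
  then show ?thesis by (simp add: M_matrix_def M_partial_def)
qed

subsection \<open>The bracket at a CMV matrix\<close>

lemma has_vector_derivative_vec_nth:
  fixes f :: "real \<Rightarrow> 'a::real_normed_vector ^ 'n::finite"
  assumes "\<And>i. ((\<lambda>t. f t $ i) has_vector_derivative f' $ i) F"
  shows "(f has_vector_derivative f') F"
  unfolding has_vector_derivative_def has_derivative_def
proof (intro conjI vec_tendstoI)
  show "bounded_linear (\<lambda>x. x *\<^sub>R f')" by (rule bounded_linear_scaleR_left)
  \<comment> \<open>\<open>Lim F (\<lambda>x. x)\<close> is the base point that
    \<open>has_derivative\<close> assigns to a general filter \<open>F\<close>.\<close>
  show "((\<lambda>y. (((f y - f (Lim F (\<lambda>x. x))) - (y - Lim F (\<lambda>x. x)) *\<^sub>R f') /\<^sub>R norm (y - Lim F (\<lambda>x. x))) $ i) \<longlongrightarrow> 0 $ i) F" for i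
    using assms[of i] by (simp add: has_vector_derivative_def has_derivative_def)
qed

lemma has_vector_derivative_block:
  assumes "p \<noteq> q"
    and "(w has_vector_derivative w') F" "(x has_vector_derivative x') F"
      "(y has_vector_derivative y') F" "(z has_vector_derivative z') F"
  shows "((\<lambda>t. block p q (w t) (x t) (y t) (z t) d) has_vector_derivative block p q w' x' y' z' 0) F"
proof (intro has_vector_derivative_vec_nth)
  fix i j
  show "((\<lambda>t. block p q (w t) (x t) (y t) (z t) d $ i $ j) has_vector_derivative block p q w' x' y' z' 0 $ i $ j) F"
    using assms
    by (cases "i = p"; cases "i = q"; cases "j = p"; cases "j = q"; cases "i = j") (simp_all add: block_nth)
qed

text \<open>Along the curve \<open>|a + c t|^2\<close> is quadratic in \<open>t\<close>. The
  direction \<open>c\<close> will be 1 or \<open>\<i>\<close>, for which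
  \<open>a \<bullet> c\<close> is the real or the imaginary part of \<open>a\<close>.\<close>

lemma has_vector_derivative_of_real_sqrt:
  assumes "cmod a < 1" "(cmod c)\<^sup>2 = 1"
  shows "((\<lambda>t. complex_of_real (sqrt (1 - (cmod (a + c * of_real t))\<^sup>2)))
    has_vector_derivative of_real (- (a \<bullet> c) / sqrt (1 - (cmod a)\<^sup>2))) (at 0)"
proof -
  have pos: "1 - (cmod a)\<^sup>2 > 0"
    using assms(1) by (simp add: abs_square_less_1)
  have "(cmod (a + c * of_real t))\<^sup>2 = (cmod a)\<^sup>2 + 2 * t * (a \<bullet> c) + t\<^sup>2 * (cmod c)\<^sup>2" for t
    unfolding cmod_power2 by (simp add: inner_complex_def power2_eq_square algebra_simps)
  then have *: "(cmod (a + c * of_real t))\<^sup>2 = (cmod a)\<^sup>2 + 2 * t * (a \<bullet> c) + t\<^sup>2" for t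
    by (simp add: assms(2))
  have "((\<lambda>t. sqrt (1 - ((cmod a)\<^sup>2 + 2 * t * (a \<bullet> c) + t\<^sup>2)))
      has_real_derivative - (a \<bullet> c) / sqrt (1 - (cmod a)\<^sup>2)) (at 0)"
    using pos by (auto intro!: derivative_eq_intros simp: divide_simps)
  then show ?thesis
    unfolding * by (rule has_vector_derivative_of_real)
qed

text \<open>An infinitesimal form, at \<open>\<alpha>\<close>, of the claim that \<open>F\<close> is
  a Poisson map from the Ablowitz--Ladik coordinates to the matrices. The set \<open>K\<close>
  bounds the coefficients on which \<open>F\<close> depends to first order.\<close>

definition AL_factor ::
  "(nat \<Rightarrow> complex) \<Rightarrow> nat set \<Rightarrow> ((nat \<Rightarrow> complex) \<Rightarrow> 'n::{finite,linorder} cmat) \<Rightarrow> bool" where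
  "AL_factor \<alpha> K F \<longleftrightarrow> (\<exists>a b.
    (\<forall>k < CARD('n) - 1.
      ((\<lambda>t. F (\<alpha>(k := \<alpha> k + of_real t))) has_vector_derivative a k) (at 0) \<and>
      ((\<lambda>t. F (\<alpha>(k := \<alpha> k + \<i> * of_real t))) has_vector_derivative b k) (at 0)) \<and>
    (\<forall>k. k \<notin> K \<longrightarrow> a k = 0 \<and> b k = 0) \<and>
    (\<forall>X. (1/2) *\<^sub>R sklyanin X (F \<alpha>) =
      (\<Sum>k < CARD('n) - 1. (rho \<alpha> k)\<^sup>2 *\<^sub>R (pairing X (a k) *\<^sub>R b k - pairing X (b k) *\<^sub>R a k))))"

text \<open>
  As \<open>K\<close> and \<open>K'\<close> are disjoint, each coefficient enters through one of the two matrices only, so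
  the product rule produces no mixed terms.
\<close>

lemma AL_factor_mult:
  fixes F G :: "(nat \<Rightarrow> complex) \<Rightarrow> 'n::{finite,linorder} cmat"
  assumes "AL_factor \<alpha> K F" "AL_factor \<alpha> K' G" "K \<inter> K' = {}" "K \<union> K' \<subseteq> K''"
  shows "AL_factor \<alpha> K'' (\<lambda>\<beta>. F \<beta> ** G \<beta>)"
proof -
  obtain a b where
    ab: "\<And>k. k < CARD('n) - 1 \<Longrightarrow> ((\<lambda>t. F (\<alpha>(k := \<alpha> k + of_real t))) has_vector_derivative a k) (at 0)"
      "\<And>k. k < CARD('n) - 1 \<Longrightarrow> ((\<lambda>t. F (\<alpha>(k := \<alpha> k + \<i> * of_real t))) has_vector_derivative b k) (at 0)"
    and ab0: "\<And>k. k \<notin> K \<Longrightarrow> a k = 0 \<and> b k = 0"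
    and F: "\<And>X. (1/2) *\<^sub>R sklyanin X (F \<alpha>) =
      (\<Sum>k < CARD('n) - 1. (rho \<alpha> k)\<^sup>2 *\<^sub>R (pairing X (a k) *\<^sub>R b k - pairing X (b k) *\<^sub>R a k))"
    using assms(1) unfolding AL_factor_def by blast
  obtain c d where
    cd: "\<And>k. k < CARD('n) - 1 \<Longrightarrow> ((\<lambda>t. G (\<alpha>(k := \<alpha> k + of_real t))) has_vector_derivative c k) (at 0)"
      "\<And>k. k < CARD('n) - 1 \<Longrightarrow> ((\<lambda>t. G (\<alpha>(k := \<alpha> k + \<i> * of_real t))) has_vector_derivative d k) (at 0)"
    and cd0: "\<And>k. k \<notin> K' \<Longrightarrow> c k = 0 \<and> d k = 0"
    and G: "\<And>X. (1/2) *\<^sub>R sklyanin X (G \<alpha>) =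
      (\<Sum>k < CARD('n) - 1. (rho \<alpha> k)\<^sup>2 *\<^sub>R (pairing X (c k) *\<^sub>R d k - pairing X (d k) *\<^sub>R c k))"
    using assms(2) unfolding AL_factor_def by blast
  let ?a = "\<lambda>k. F \<alpha> ** c k + a k ** G \<alpha>" and ?b = "\<lambda>k. F \<alpha> ** d k + b k ** G \<alpha>"
  have "(1/2) *\<^sub>R sklyanin X (F \<alpha> ** G \<alpha>) =
    (\<Sum>k < CARD('n) - 1. (rho \<alpha> k)\<^sup>2 *\<^sub>R (pairing X (?a k) *\<^sub>R ?b k - pairing X (?b k) *\<^sub>R ?a k))" for X
  proof -
    have "(1/2) *\<^sub>R sklyanin X (F \<alpha> ** G \<alpha>) =
      F \<alpha> ** ((1/2) *\<^sub>R sklyanin (X ** F \<alpha>) (G \<alpha>)) + ((1/2) *\<^sub>R sklyanin (G \<alpha> ** X) (F \<alpha>)) ** G \<alpha>"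
      by (simp add: sklyanin_mult matrix_mult.scaleR_left matrix_mult.scaleR_right scaleR_add_right)
    also have "\<dots> = (\<Sum>k < CARD('n) - 1.
      F \<alpha> ** ((rho \<alpha> k)\<^sup>2 *\<^sub>R (pairing (X ** F \<alpha>) (c k) *\<^sub>R d k - pairing (X ** F \<alpha>) (d k) *\<^sub>R c k)) +
      (rho \<alpha> k)\<^sup>2 *\<^sub>R (pairing (G \<alpha> ** X) (a k) *\<^sub>R b k - pairing (G \<alpha> ** X) (b k) *\<^sub>R a k) ** G \<alpha>)"
      unfolding F G by (simp add: matrix_mult.sum_left matrix_mult.sum_right sum.distrib)
    also have "\<dots> = (\<Sum>k < CARD('n) - 1.
      (rho \<alpha> k)\<^sup>2 *\<^sub>R (pairing X (?a k) *\<^sub>R ?b k - pairing X (?b k) *\<^sub>R ?a k))"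
    proof (rule sum.cong[OF refl])
      fix k
      have "k \<notin> K \<or> k \<notin> K'" using assms(3) by blast
      then show "F \<alpha> ** ((rho \<alpha> k)\<^sup>2 *\<^sub>R (pairing (X ** F \<alpha>) (c k) *\<^sub>R d k - pairing (X ** F \<alpha>) (d k) *\<^sub>R c k)) +
          (rho \<alpha> k)\<^sup>2 *\<^sub>R (pairing (G \<alpha> ** X) (a k) *\<^sub>R b k - pairing (G \<alpha> ** X) (b k) *\<^sub>R a k) ** G \<alpha> =
        (rho \<alpha> k)\<^sup>2 *\<^sub>R (pairing X (?a k) *\<^sub>R ?b k - pairing X (?b k) *\<^sub>R ?a k)"
      proof
        assume "k \<notin> K"
        then have "a k = 0" "b k = 0" using ab0 by auto
        \<comment> \<open>Now \<open>?a k\<close> and \<open>?b k\<close> reduce to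
          \<open>F \<alpha> ** c k\<close> and \<open>F \<alpha> ** d k\<close>, and
          \<open>F \<alpha>\<close> passes from one argument of the pairing to the other.\<close>
        then show ?thesis
          by (simp add: pairing_mult_right matrix_mult.zero_left matrix_mult.scaleR_right
            matrix_mult.diff_right)
      next
        assume "k \<notin> K'"
        then have "c k = 0" "d k = 0" using cd0 by auto
        then show ?thesis
          by (simp add: pairing_mult_left matrix_mult.zero_right matrix_mult.scaleR_left
            matrix_mult.diff_left)
      qed
    qed
    finally show ?thesis .
  qed
  moreover have "?a k = 0 \<and> ?b k = 0" if "k \<notin> K''" for k
  proof -
    have "k \<notin> K" "k \<notin> K'" using that assms(4) by auto
    then show ?thesis
      by (simp add: ab0 cd0 matrix_mult.zero_left matrix_mult.zero_right)
  qed
  moreover have "((\<lambda>t. F (\<alpha>(k := \<alpha> k + of_real t)) ** G (\<alpha>(k := \<alpha> k + of_real t))) has_vector_derivative ?a k) (at 0)"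
    if "k < CARD('n) - 1" for k
    using matrix_mult.has_vector_derivative[OF ab(1) cd(1), OF that that] by simp
  moreover have "((\<lambda>t. F (\<alpha>(k := \<alpha> k + \<i> * of_real t)) ** G (\<alpha>(k := \<alpha> k + \<i> * of_real t))) has_vector_derivative ?b k) (at 0)"
    if "k < CARD('n) - 1" for k
    using matrix_mult.has_vector_derivative[OF ab(2) cd(2), OF that that] by simp
  ultimately show ?thesis
    unfolding AL_factor_def by (intro exI[of _ ?a] exI[of _ ?b]) blast
qed

text \<open>Zero derivatives and a zero field meet the condition for every \<open>K\<close>. This
  covers the identity and the factors that involve none of the free coefficients.\<close>

lemma AL_factor_const:
  assumes "\<And>k c. k < CARD('n) - 1 \<Longrightarrow> F (\<alpha>(k := c)) = F \<alpha>" "\<And>X. sklyanin X (F \<alpha>) = 0"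
  shows "AL_factor \<alpha> K (F :: _ \<Rightarrow> 'n::{finite,linorder} cmat)"
  unfolding AL_factor_def using assms
  by (intro exI[of _ "\<lambda>_. 0"]) (simp add: pairing_eq_inner)

lemma Xi_factor_upd: "j \<noteq> k \<Longrightarrow> Xi_factor k (\<alpha>(j := c)) = Xi_factor k \<alpha>"
  by (simp add: Xi_factor_def Xi_def rho_def vec_eq_iff)

lemma AL_factor_Xi_factor:
  assumes \<alpha>: "verblunsky CARD('n) \<alpha>"
  shows "AL_factor \<alpha> {k} (Xi_factor k :: _ \<Rightarrow> 'n::{finite,linorder} cmat)"
proof (cases "k < CARD('n) - 1")
  case False
  show ?thesis
  proof (rule AL_factor_const)
    show "(Xi_factor k (\<alpha>(j := c)) :: 'n cmat) = Xi_factor k \<alpha>" if "j < CARD('n) - 1" for j c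
      using that False by (intro Xi_factor_upd) auto
    have "(Xi_factor k \<alpha> :: 'n cmat) =
      (\<chi> i j. if i = j then (if idx i = CARD('n) - 1 \<and> k = CARD('n) - 1 then cnj (\<alpha> k) else 1) else 0)"
      using False by (intro Xi_factor_eq_diagonal) simp
    then show "sklyanin X (Xi_factor k \<alpha>) = 0" for X :: "'n cmat"
      using \<alpha> by (simp only:) (rule sklyanin_diagonal, simp add: verblunsky_def)
  qed
next
  case True
  then have "k < CARD('n)" "Suc k < CARD('n)" by linarith+
  then obtain p q :: 'n where p: "idx p = k" and q: "idx q = Suc k" by (metis obtain_idx)
  have a1: "cmod (\<alpha> k) < 1" using \<alpha> True by (simp add: verblunsky_def)
  then have "1 - (cmod (\<alpha> k))\<^sup>2 > 0" by (simp add: abs_square_less_1)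
  then have rho: "rho \<alpha> k > 0" "(rho \<alpha> k)\<^sup>2 = 1 - (cmod (\<alpha> k))\<^sup>2"
    by (simp_all add: rho_def)
  have pq: "p < q" "p \<noteq> q" using p q by (auto simp flip: idx_less_iff)
  \<comment> \<open>\<open>p\<close> and \<open>q\<close> carry consecutive numbers, so no index
    separates them.\<close>
  have between: "i < p \<longleftrightarrow> i < q" if "i \<noteq> p" "i \<noteq> q" for i
  proof -
    have "idx i \<noteq> k" using that p by (metis idx_eq_iff)
    then show ?thesis unfolding idx_less_iff[symmetric] using p q by linarith
  qed
  let ?Eu = "block p q 1 (of_real (- Re (\<alpha> k) / rho \<alpha> k)) (of_real (- Re (\<alpha> k) / rho \<alpha> k)) (- 1) 0"
  let ?Ev = "block p q (- \<i>) (of_real (- Im (\<alpha> k) / rho \<alpha> k)) (of_real (- Im (\<alpha> k) / rho \<alpha> k)) (- \<i>) 0"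
  \<comment> \<open>The choices \<open>c = 1\<close> and \<open>c = \<i>\<close> turn this
    derivative into \<open>?Eu\<close> and \<open>?Ev\<close>.\<close>
  have deriv: "((\<lambda>t. Xi_factor k (\<alpha>(k := \<alpha> k + c * of_real t))) has_vector_derivative
      block p q (cnj c) (of_real (- (\<alpha> k \<bullet> c) / rho \<alpha> k)) (of_real (- (\<alpha> k \<bullet> c) / rho \<alpha> k)) (- c) 0) (at 0)"
    if "(cmod c)\<^sup>2 = 1" for c
  proof -
    have "((\<lambda>t. \<alpha> k + c * of_real t) has_vector_derivative c) (at 0)"
      unfolding has_vector_derivative_def
      by (auto intro!: derivative_eq_intros simp: scaleR_conv_of_real mult.commute)
    then show ?thesis
      unfolding Xi_factor_eq_block[OF p q] fun_upd_same rho_def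
      using that a1
      by (intro has_vector_derivative_block has_vector_derivative_of_real_sqrt pq
        has_vector_derivative_cnj has_vector_derivative_minus)
  qed
  show ?thesis
    unfolding AL_factor_def
  proof (intro exI conjI allI impI)
    let ?a = "\<lambda>j. if j = k then ?Eu else 0" and ?b = "\<lambda>j. if j = k then ?Ev else 0"
    show "((\<lambda>t. Xi_factor k (\<alpha>(j := \<alpha> j + of_real t))) has_vector_derivative ?a j) (at 0)" for j
      using deriv[of 1] by (cases "j = k") (simp_all add: Xi_factor_upd inner_complex_def)
    show "((\<lambda>t. Xi_factor k (\<alpha>(j := \<alpha> j + \<i> * of_real t))) has_vector_derivative ?b j) (at 0)" for j
      using deriv[of \<i>] by (cases "j = k") (simp_all add: Xi_factor_upd inner_complex_def)
    show "?a j = 0" "?b j = 0" if "j \<notin> {k}" for j using that by auto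
    fix X
    have "(1/2) *\<^sub>R sklyanin X (Xi_factor k \<alpha>) =
      (rho \<alpha> k)\<^sup>2 *\<^sub>R (pairing X ?Eu *\<^sub>R ?Ev - pairing X ?Ev *\<^sub>R ?Eu)"
      unfolding Xi_factor_eq_block[OF p q] by (rule sklyanin_block[OF pq(1) between rho])
    also have "\<dots> = (\<Sum>j\<in>{k}. (rho \<alpha> j)\<^sup>2 *\<^sub>R (pairing X (?a j) *\<^sub>R ?b j - pairing X (?b j) *\<^sub>R ?a j))"
      by simp
    also have "\<dots> = (\<Sum>j < CARD('n) - 1. (rho \<alpha> j)\<^sup>2 *\<^sub>R (pairing X (?a j) *\<^sub>R ?b j - pairing X (?b j) *\<^sub>R ?a j))"
      using True by (intro sum.mono_neutral_left) auto
    finally show "(1/2) *\<^sub>R sklyanin X (Xi_factor k \<alpha>) =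
      (\<Sum>j < CARD('n) - 1. (rho \<alpha> j)\<^sup>2 *\<^sub>R (pairing X (?a j) *\<^sub>R ?b j - pairing X (?b j) *\<^sub>R ?a j))" .
  qed
qed

lemma AL_factor_mat_1: "AL_factor \<alpha> K (\<lambda>_. mat 1)"
  by (rule AL_factor_const) (simp_all add: sklyanin_def)

text \<open>Each step brings in a new coefficient, of even index in the first matrix and of odd
  index in the second, so the index sets stay disjoint in every product.\<close>

lemma AL_factor_cmv:
  assumes \<alpha>: "verblunsky CARD('n) \<alpha>"
  shows "AL_factor \<alpha> UNIV (cmv :: _ \<Rightarrow> 'n::{finite,linorder} cmat)"
proof -
  have L: "AL_factor \<alpha> {j. even j \<and> j < 2 * m} (L_partial m :: _ \<Rightarrow> 'n cmat)" for m
  proof (induction m)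
    case 0
    then show ?case using AL_factor_mat_1 by (simp add: L_partial_0[abs_def])
  next
    case (Suc m)
    show ?case
      unfolding L_partial_Suc[abs_def]
      by (rule AL_factor_mult[OF Suc AL_factor_Xi_factor[OF \<alpha>]]) auto
  qed
  have M: "AL_factor \<alpha> {j. odd j \<and> j < 2 * m} (M_partial m :: _ \<Rightarrow> 'n cmat)" for m
  proof (induction m)
    case 0
    then show ?case using AL_factor_mat_1 by (simp add: M_partial_0[abs_def])
  next
    case (Suc m)
    show ?case
      unfolding M_partial_Suc[abs_def]
      by (rule AL_factor_mult[OF Suc AL_factor_Xi_factor[OF \<alpha>]]) auto
  qed
  show ?thesis
    unfolding cmv_def[abs_def] L_matrix_eq_partial M_matrix_eq_partial
    by (rule AL_factor_mult[OF L M]) auto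
qed

text \<open>Factors with \<open>k < n - 1\<close> have determinant \<open>- 1\<close>, and the
  remaining ones see only the last coefficient. Hence varying a free coefficient inside the disk
  stays on the manifold.\<close>

lemma det_cmv_eq:
  assumes "verblunsky CARD('n) \<alpha>" "verblunsky CARD('n) \<beta>" "\<alpha> (CARD('n) - 1) = \<beta> (CARD('n) - 1)"
  shows "det (cmv \<alpha> :: 'n::{finite,linorder} cmat) = det (cmv \<beta> :: 'n cmat)"
proof -
  have Xi: "det (Xi_factor k \<alpha> :: 'n cmat) = det (Xi_factor k \<beta> :: 'n cmat)" for k
  proof (cases "k < CARD('n) - 1")
    case True
    then show ?thesis by (simp only: det_Xi_factor assms)
  next
    case False
    then have "CARD('n) - 1 \<le> k" by simp
    moreover have "(if idx i = CARD('n) - 1 \<and> k = CARD('n) - 1 then cnj (\<alpha> k) else 1) =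
        (if idx i = CARD('n) - 1 \<and> k = CARD('n) - 1 then cnj (\<beta> k) else 1)" for i :: 'n
      using assms(3) by simp
    ultimately show ?thesis
      by (simp only: Xi_factor_eq_diagonal)
  qed
  have "det (L_partial m \<alpha> :: 'n cmat) = det (L_partial m \<beta> :: 'n cmat)" for m
    by (induction m) (simp_all only: L_partial_0 L_partial_Suc det_mul Xi)
  moreover have "det (M_partial m \<alpha> :: 'n cmat) = det (M_partial m \<beta> :: 'n cmat)" for m
    by (induction m) (simp_all only: M_partial_0 M_partial_Suc det_mul Xi)
  ultimately show ?thesis
    by (simp only: cmv_def L_matrix_eq_partial M_matrix_eq_partial det_mul)
qed

subsection \<open>Verblunsky coefficients as functions of the matrix\<close>

text \<open>A row of the first matrix is supported in its block, and
  \<open>Suc (2 * m) < CARD('n)\<close> ensures that this block is a full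
  \<open>2 \<times> 2\<close> one.\<close>

lemma cmv_nth:
  fixes p q :: "'n::{finite,linorder}"
  assumes "Suc (2 * m) < CARD('n)" "idx p div 2 = m"
  shows "cmv \<beta> $ p $ q =
    Xi \<beta> (2 * m) (idx p mod 2) 0 * M_entry \<beta> (2 * m) (idx q) +
    Xi \<beta> (2 * m) (idx p mod 2) 1 * M_entry \<beta> (Suc (2 * m)) (idx q)"
proof -
  have "2 * m < CARD('n)" using assms(1) by simp
  then obtain u v :: 'n where u: "idx u = 2 * m" and v: "idx v = Suc (2 * m)"
    using assms(1) by (metis obtain_idx)
  then have "u \<noteq> v" by auto
  have "cmv \<beta> $ p $ q = (\<Sum>l\<in>(UNIV :: 'n set). L_entry \<beta> (idx p) (idx l) * M_entry \<beta> (idx l) (idx q))"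
    by (simp add: cmv_def matrix_matrix_mult_def L_matrix_def M_matrix_def)
  also have "\<dots> = L_entry \<beta> (idx p) (idx u) * M_entry \<beta> (idx u) (idx q) +
    L_entry \<beta> (idx p) (idx v) * M_entry \<beta> (idx v) (idx q)"
  proof (rule sum_two_points[OF \<open>u \<noteq> v\<close>])
    fix l
    assume "l \<noteq> u" "l \<noteq> v"
    then have "idx l \<noteq> 2 * m" "idx l \<noteq> Suc (2 * m)" using u v by (metis idx_eq_iff)+
    then have "idx l div 2 \<noteq> m" by presburger
    then show "L_entry \<beta> (idx p) (idx l) * M_entry \<beta> (idx l) (idx q) = 0"
      using assms(2) by (simp add: L_entry_def)
  qed
  finally show ?thesis
    using assms(2) by (simp add: u v L_entry_def)
qed

lemma cmv_entries_0:
  assumes "1 < CARD('n::{finite,linorder})"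
  obtains p q :: "'n::{finite,linorder}" where "\<And>\<beta>. cmv \<beta> $ p $ p = cnj (\<beta> 0)" "\<And>\<beta>. cmv \<beta> $ q $ p = of_real (rho \<beta> 0)"
proof -
  have "0 < CARD('n)" using assms by simp
  then obtain p q :: 'n where p: "idx p = 0" and q: "idx q = 1"
    using assms by (metis obtain_idx)
  have "cmv \<beta> $ p $ p = cnj (\<beta> 0)" "cmv \<beta> $ q $ p = of_real (rho \<beta> 0)" for \<beta>
    using assms by (simp_all add: cmv_nth[where m = 0] p q M_entry_def Xi_def)
  then show ?thesis using that by blast
qed

text \<open>These entries link neighbouring coefficients and allow them to be recovered from the
  matrix one after the other.\<close>

lemma cmv_entries_Suc:
  assumes "Suc (Suc k) < CARD('n::{finite,linorder})"
  obtains p q s t :: "'n::{finite,linorder}" where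
    "\<And>\<beta>. cmv \<beta> $ p $ q = of_real (rho \<beta> k) * of_real (rho \<beta> (Suc k))"
    "\<And>\<beta>. cmv \<beta> $ s $ t = of_real (rho \<beta> k) * cnj (\<beta> (Suc k))"
proof -
  have "k < CARD('n)" "Suc k < CARD('n)" using assms by simp_all
  then obtain u v w :: 'n where u: "idx u = k" and v: "idx v = Suc k" and w: "idx w = Suc (Suc k)"
    using assms by (metis obtain_idx)
  show ?thesis
  \<comment> \<open>For even \<open>k\<close> the entries are at \<open>(k, k + 2)\<close> and
    \<open>(k, k + 1)\<close>; for odd \<open>k\<close> they are at the transposed
    positions.\<close>
  proof (cases "even k")
    case True
    then obtain m where m: "k = 2 * m" by blast
    have "cmv \<beta> $ u $ w = of_real (rho \<beta> k) * of_real (rho \<beta> (Suc k))"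
      "cmv \<beta> $ u $ v = of_real (rho \<beta> k) * cnj (\<beta> (Suc k))" for \<beta>
      using assms by (simp_all add: cmv_nth[where m = m] u v w m M_entry_def Xi_def)
    then show ?thesis using that by blast
  next
    case False
    then obtain m where m: "k = Suc (2 * m)" by (auto elim: oddE)
    have "cmv \<beta> $ w $ u = of_real (rho \<beta> k) * of_real (rho \<beta> (Suc k))"
      "cmv \<beta> $ v $ u = of_real (rho \<beta> k) * cnj (\<beta> (Suc k))" for \<beta>
      using assms by (simp_all add: cmv_nth[where m = "Suc m"] u v w m M_entry_def Xi_def)
    then show ?thesis using that by blast
  qed
qed

lemma bounded_linear_entry: "bounded_linear (\<lambda>C :: 'n::finite cmat. C $ p $ q)"
  using bounded_linear_compose[OF bounded_linear_vec_nth bounded_linear_vec_nth] .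

lemma rho_pos:
  assumes "verblunsky n \<alpha>" "k < n - 1"
  shows "rho \<alpha> k > 0"
  using assms by (simp add: verblunsky_def rho_def abs_square_less_1)

text \<open>Recursively, \<open>\<rho>\<^sub>k\<^sub>+\<^sub>1\<close> is the entry
  \<open>\<rho>\<^sub>k \<rho>\<^sub>k\<^sub>+\<^sub>1\<close> divided by the extension of
  \<open>\<rho>\<^sub>k\<close>. The extensions are kept nonzero on their neighbourhoods so that the
  next division is smooth.\<close>

lemma smooth_rho_extension:
  assumes "verblunsky CARD('n::{finite,linorder}) \<alpha>" "k < CARD('n) - 1"
  shows "\<exists>U r. open U \<and> (cmv \<alpha> :: 'n cmat) \<in> U \<and> smooth_fun_on r U \<and> (\<forall>C\<in>U. r C \<noteq> 0) \<and>
    (\<forall>\<beta>. cmv \<beta> \<in> U \<longrightarrow> r (cmv \<beta>) = complex_of_real (rho \<beta> k))"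
  using assms(2)
proof (induction k)
  case 0
  then have "1 < CARD('n)" by simp
  then obtain p q :: 'n where q: "\<And>\<beta>. cmv \<beta> $ q $ p = of_real (rho \<beta> 0)"
    using cmv_entries_0 by metis
  let ?r = "\<lambda>C :: 'n cmat. C $ q $ p"
  have "open {C. ?r C \<noteq> 0}"
    by (intro open_Collect_neq linear_continuous_on bounded_linear_entry continuous_intros)
  moreover have "rho \<alpha> 0 \<noteq> 0" using rho_pos[OF assms(1) 0] by simp
  ultimately show ?case
    using q by (intro exI[of _ "{C. ?r C \<noteq> 0}"] exI[of _ ?r])
      (simp add: smooth_fun_on_linear bounded_linear_entry)
next
  case (Suc k)
  then have "k < CARD('n) - 1" by simp
  from Suc.IH[OF this] obtain U r where
    U: "open U" "(cmv \<alpha> :: 'n cmat) \<in> U" "smooth_fun_on r U" "\<forall>C\<in>U. r C \<noteq> 0"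
      "\<forall>\<beta>. cmv \<beta> \<in> U \<longrightarrow> r (cmv \<beta>) = complex_of_real (rho \<beta> k)" by blast
  have "Suc (Suc k) < CARD('n)" using Suc.prems by simp
  then obtain p q :: 'n where
    pq: "\<And>\<beta>. cmv \<beta> $ p $ q = of_real (rho \<beta> k) * of_real (rho \<beta> (Suc k))"
    using cmv_entries_Suc by metis
  \<comment> \<open>The neighbourhood shrinks to where the new numerator is nonzero, which preserves
    the invariant.\<close>
  let ?V = "U \<inter> {C. C $ p $ q \<noteq> 0}" and ?r = "\<lambda>C. C $ p $ q * inverse (r C)"
  have V: "open ?V"
    by (intro open_Int U(1) open_Collect_neq linear_continuous_on bounded_linear_entry continuous_intros)
  moreover have "cmv \<alpha> \<in> ?V"
    using U(2) rho_pos[OF assms(1) \<open>k < CARD('n) - 1\<close>] rho_pos[OF assms(1) Suc.prems] by (simp add: pq)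
  moreover have "smooth_fun_on ?r ?V"
    using U(4) by (intro smooth_fun_on_mult V smooth_fun_on_inverse smooth_fun_on_linear
      bounded_linear_entry smooth_fun_on_subset[OF U(3)]) auto
  moreover have "\<forall>C\<in>?V. ?r C \<noteq> 0" using U(4) by simp
  moreover have "\<forall>\<beta>. cmv \<beta> \<in> ?V \<longrightarrow> ?r (cmv \<beta>) = of_real (rho \<beta> (Suc k))"
    using U(4,5) by (auto simp: pq)
  ultimately show ?case by blast
qed

text \<open>Division of \<open>\<rho>\<^sub>k\<^sub>-\<^sub>1\<close> out of a matrix entry leaves
  the conjugate of the coefficient. This supplies the existence half of
  \<open>has_manifold_gd_bracket\<close>.\<close>

lemma smooth_on_manifold_at_coefficient:
  assumes "verblunsky CARD('n::{finite,linorder}) \<alpha>" "k < CARD('n) - 1"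
  shows "smooth_on_manifold_at (\<lambda>\<beta>. \<beta> k) (cmv \<alpha> :: 'n cmat)"
proof (cases k)
  case 0
  then have "1 < CARD('n)" using assms(2) by simp
  then obtain p :: 'n where p: "\<And>\<beta>. cmv \<beta> $ p $ p = cnj (\<beta> 0)"
    using cmv_entries_0 by metis
  have "smooth_fun_on (\<lambda>C :: 'n cmat. cnj (C $ p $ p)) UNIV"
    by (intro smooth_fun_on_linear bounded_linear_compose[OF bounded_linear_cnj] bounded_linear_entry)
  then show ?thesis
    unfolding smooth_on_manifold_at_def smooth_extension_def
    by (intro exI[of _ "\<lambda>C. cnj (C $ p $ p)"] exI[of _ UNIV]) (simp add: p 0)
next
  case (Suc k')
  then have "k' < CARD('n) - 1" using assms(2) by simp
  from smooth_rho_extension[OF assms(1) this] obtain U r where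
    U: "open U" "(cmv \<alpha> :: 'n cmat) \<in> U" "smooth_fun_on r U" "\<forall>C\<in>U. r C \<noteq> 0"
      "\<forall>\<beta>. cmv \<beta> \<in> U \<longrightarrow> r (cmv \<beta>) = complex_of_real (rho \<beta> k')" by blast
  have "Suc (Suc k') < CARD('n)" using assms(2) Suc by simp
  then obtain p q :: 'n where pq: "\<And>\<beta>. cmv \<beta> $ p $ q = of_real (rho \<beta> k') * cnj (\<beta> (Suc k'))"
    using cmv_entries_Suc by metis
  \<comment> \<open>On CMV matrices \<open>r\<close> is real, so it is enough to conjugate the
    entry.\<close>
  let ?\<phi> = "\<lambda>C. cnj (C $ p $ q) * inverse (r C)"
  have "smooth_fun_on ?\<phi> U"
    using U(4) by (intro smooth_fun_on_mult U(1,3) smooth_fun_on_inverse smooth_fun_on_linear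
      bounded_linear_compose[OF bounded_linear_cnj] bounded_linear_entry) auto
  moreover have "?\<phi> (cmv \<beta>) = \<beta> k" if "cmv \<beta> \<in> U" for \<beta>
    using U(4,5) that by (auto simp: pq Suc)
  ultimately show ?thesis
    unfolding smooth_on_manifold_at_def smooth_extension_def
    using U(1,2) by (intro exI[of _ ?\<phi>] exI[of _ U]) simp
qed

lemma smooth_on_manifold_at_cnj:
  assumes "smooth_on_manifold_at f B"
  shows "smooth_on_manifold_at (\<lambda>\<beta>. cnj (f \<beta>)) B"
proof -
  obtain \<phi> U where "open U" "B \<in> U" "smooth_fun_on \<phi> U"
    "\<forall>\<beta>. verblunsky CARD('a) \<beta> \<and> det (cmv \<beta> :: 'a cmat) = det B \<and> cmv \<beta> \<in> U \<longrightarrow> \<phi> (cmv \<beta>) = f \<beta>"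
    using assms unfolding smooth_on_manifold_at_def smooth_extension_def by blast
  then show ?thesis
    unfolding smooth_on_manifold_at_def smooth_extension_def
    by (intro exI[of _ "\<lambda>C. cnj (\<phi> C)"] exI[of _ U])
      (simp add: smooth_fun_on_compose_linear bounded_linear_cnj)
qed

subsection \<open>Restriction to the manifold\<close>

text \<open>For small \<open>t\<close> the curve stays in the disk, keeps its last coefficient and
  hence its determinant, and remains in the domain of the extension. There \<open>\<phi>\<close>
  agrees with \<open>f\<close>, and the chain rule applies. The map \<open>h\<close> will be
  \<open>Re\<close> or \<open>Im\<close>.\<close>

lemma deriv_along_coordinate:
  fixes \<alpha> :: "nat \<Rightarrow> complex"
  assumes \<alpha>: "verblunsky CARD('n::{finite,linorder}) \<alpha>" and k: "k < CARD('n) - 1"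
    and \<phi>: "smooth_extension f \<phi> (cmv \<alpha> :: 'n cmat)"
    and D: "(\<phi> has_derivative D) (at (cmv \<alpha>))" and h: "bounded_linear h"
    and a: "((\<lambda>t. cmv (\<alpha>(k := \<alpha> k + c * of_real t)) :: 'n cmat) has_vector_derivative a) (at 0)"
  shows "deriv (\<lambda>t. (h \<circ> f) (\<alpha>(k := \<alpha> k + c * of_real t))) 0 = h (D a)"
proof -
  let ?\<gamma> = "\<lambda>t. \<alpha>(k := \<alpha> k + c * of_real t)"
  obtain U :: "'n cmat set" where U: "open U" "cmv \<alpha> \<in> U"
    and ext: "\<And>\<beta>. verblunsky CARD('n) \<beta> \<Longrightarrow> det (cmv \<beta> :: 'n cmat) = det (cmv \<alpha> :: 'n cmat) \<Longrightarrow>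
      cmv \<beta> \<in> U \<Longrightarrow> \<phi> (cmv \<beta>) = f \<beta>"
    using \<phi> unfolding smooth_extension_def by blast
  have "((\<lambda>t. \<phi> (cmv (?\<gamma> t))) has_derivative (\<lambda>t. D (t *\<^sub>R a))) (at 0)"
    using has_derivative_compose[OF a[unfolded has_vector_derivative_def], of \<phi> D] D by simp
  then have "((\<lambda>t. h (\<phi> (cmv (?\<gamma> t)))) has_derivative (\<lambda>t. h (D (t *\<^sub>R a)))) (at 0)"
    by (rule bounded_linear.has_derivative[OF h])
  then have deriv: "((\<lambda>t. h (\<phi> (cmv (?\<gamma> t)))) has_real_derivative h (D a)) (at 0)"
    using D h
    by (simp add: has_field_derivative_def linear_cmul has_derivative_linear bounded_linear.linear
        mult.commute[of _ "h (D a)"])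
  have "isCont (\<lambda>t. cmv (?\<gamma> t) :: 'n cmat) 0"
    using a by (rule has_vector_derivative_continuous)
  then have "\<forall>\<^sub>F t in nhds 0. (cmv (?\<gamma> t) :: 'n cmat) \<in> U"
    using U by (intro topological_tendstoD) (simp_all add: isCont_def tendsto_nhds_iff)
  moreover have "\<forall>\<^sub>F t in nhds 0. cmod (\<alpha> k + c * of_real t) < 1"
  proof (rule order_tendstoD(2))
    show "((\<lambda>t. cmod (\<alpha> k + c * of_real t)) \<longlongrightarrow> cmod (\<alpha> k + c * of_real 0)) (nhds 0)"
      by (intro tendsto_intros) (simp add: filterlim_ident)
    show "cmod (\<alpha> k + c * of_real 0) < 1" using \<alpha> k by (simp add: verblunsky_def)
  qed
  ultimately have "\<forall>\<^sub>F t in nhds 0. h (\<phi> (cmv (?\<gamma> t))) = (h \<circ> f) (?\<gamma> t)"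
  proof eventually_elim
    case (elim t)
    have "verblunsky CARD('n) (?\<gamma> t)"
      using \<alpha> elim(2) k by (auto simp: verblunsky_def)
    moreover from this have "det (cmv (?\<gamma> t) :: 'n cmat) = det (cmv \<alpha> :: 'n cmat)"
      using \<alpha> k by (intro det_cmv_eq) auto
    ultimately show ?case
      using ext elim(1) by simp
  qed
  then have "deriv (\<lambda>t. (h \<circ> f) (?\<gamma> t)) 0 = deriv (\<lambda>t. h (\<phi> (cmv (?\<gamma> t)))) 0"
    by (intro deriv_cong_ev) (auto elim: eventually_mono)
  then show ?thesis
    using deriv by (simp add: DERIV_imp_deriv)
qed

text \<open>The field at a CMV matrix is a combination of coordinate derivatives of
  \<open>cmv\<close>, so the gradients enter only through derivatives along the manifold. This is
  why the choice of the extensions does not affect the value.\<close>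

lemma gd_bracket_extension:
  fixes \<alpha> :: "nat \<Rightarrow> complex"
  assumes \<alpha>: "verblunsky CARD('n::{finite,linorder}) \<alpha>"
    and \<phi>: "smooth_extension f \<phi> (cmv \<alpha> :: 'n cmat)"
    and \<psi>: "smooth_extension g \<psi> (cmv \<alpha> :: 'n cmat)"
    and h: "bounded_linear h" "bounded_linear h'"
  shows "gd_bracket (h \<circ> \<phi>) (h' \<circ> \<psi>) (cmv \<alpha>) = al_bracket CARD('n) (h \<circ> f) (h' \<circ> g) \<alpha>"
proof -
  let ?B = "cmv \<alpha> :: 'n cmat"
  obtain a b where
    a: "\<And>k. k < CARD('n) - 1 \<Longrightarrow>
      ((\<lambda>t. cmv (\<alpha>(k := \<alpha> k + of_real t)) :: 'n cmat) has_vector_derivative a k) (at 0)"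
    and b: "\<And>k. k < CARD('n) - 1 \<Longrightarrow>
      ((\<lambda>t. cmv (\<alpha>(k := \<alpha> k + \<i> * of_real t)) :: 'n cmat) has_vector_derivative b k) (at 0)"
    and field: "\<And>X. (1/2) *\<^sub>R sklyanin X ?B =
      (\<Sum>k < CARD('n) - 1. (rho \<alpha> k)\<^sup>2 *\<^sub>R (pairing X (a k) *\<^sub>R b k - pairing X (b k) *\<^sub>R a k))"
    using AL_factor_cmv[OF \<alpha>] unfolding AL_factor_def by blast
  \<comment> \<open>Stated for fresh \<open>f\<close>, \<open>\<phi>\<close> and \<open>h\<close>,
    as it is applied to both arguments of the bracket.\<close>
  have partial: "pairing (grad (h \<circ> \<phi>) ?B) (a k) = partial_u k (h \<circ> f) \<alpha>"
      "pairing (grad (h \<circ> \<phi>) ?B) (b k) = partial_v k (h \<circ> f) \<alpha>"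
    if \<phi>: "smooth_extension f \<phi> ?B" and h: "bounded_linear h" and k: "k < CARD('n) - 1" for f \<phi> h k
  proof -
    obtain D where D: "(\<phi> has_derivative D) (at ?B)"
      using \<phi> smooth_fun_on_differentiable unfolding smooth_extension_def differentiable_def by blast
    have "((h \<circ> \<phi>) has_derivative (\<lambda>C. h (D C))) (at ?B)"
      using bounded_linear.has_derivative[OF h D] by (simp add: o_def)
    note grad = pairing_grad[OF this]
    show "pairing (grad (h \<circ> \<phi>) ?B) (a k) = partial_u k (h \<circ> f) \<alpha>"
      using deriv_along_coordinate[OF \<alpha> k \<phi> D h, of 1 "a k"] a[OF k] by (simp add: grad partial_u_def)
    show "pairing (grad (h \<circ> \<phi>) ?B) (b k) = partial_v k (h \<circ> f) \<alpha>"
      using deriv_along_coordinate[OF \<alpha> k \<phi> D h, of \<i> "b k"] b[OF k] by (simp add: grad partial_v_def)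
  qed
  have "gd_bracket (h \<circ> \<phi>) (h' \<circ> \<psi>) ?B =
    pairing (grad (h' \<circ> \<psi>) ?B) ((1/2) *\<^sub>R sklyanin (grad (h \<circ> \<phi>) ?B) ?B)"
    by (simp add: gd_bracket_eq_sklyanin pairing_scaleR_right)
  also have "\<dots> = al_bracket CARD('n) (h \<circ> f) (h' \<circ> g) \<alpha>"
    unfolding field al_bracket_def pairing_sum_right pairing_scaleR_right pairing_diff_right
    using partial[OF \<phi> h(1)] partial[OF \<psi> h(2)] by (intro sum.cong) simp_all
  finally show ?thesis .
qed

section \<open>The Ablowitz--Ladik brackets of the coefficients\<close>

lemma partial_Re_Im_coefficient:
  "partial_u j (Re \<circ> (\<lambda>\<beta>. \<beta> k)) \<alpha> = (if j = k then 1 else 0)"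
  "partial_v j (Re \<circ> (\<lambda>\<beta>. \<beta> k)) \<alpha> = 0"
  "partial_u j (Im \<circ> (\<lambda>\<beta>. \<beta> k)) \<alpha> = 0"
  "partial_v j (Im \<circ> (\<lambda>\<beta>. \<beta> k)) \<alpha> = (if j = k then 1 else 0)"
  "partial_u j (Re \<circ> (\<lambda>\<beta>. cnj (\<beta> k))) \<alpha> = (if j = k then 1 else 0)"
  "partial_v j (Re \<circ> (\<lambda>\<beta>. cnj (\<beta> k))) \<alpha> = 0"
  "partial_u j (Im \<circ> (\<lambda>\<beta>. cnj (\<beta> k))) \<alpha> = 0"
  "partial_v j (Im \<circ> (\<lambda>\<beta>. cnj (\<beta> k))) \<alpha> = (if j = k then - 1 else 0)"
  unfolding partial_u_def partial_v_def
  by (cases "j = k"; auto intro!: DERIV_imp_deriv derivative_eq_intros)+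

text \<open>Only the brackets of a real with an imaginary part survive. The two such terms cancel
  for a pair of coefficients and add up when the second one is conjugated.\<close>

lemma al_bracket_coefficients:
  assumes "k < n - 1"
  shows "complexify (al_bracket n) (\<lambda>\<beta>. \<beta> k) (\<lambda>\<beta>. \<beta> l) \<alpha> = 0"
    "complexify (al_bracket n) (\<lambda>\<beta>. \<beta> k) (\<lambda>\<beta>. cnj (\<beta> l)) \<alpha> =
      (if k = l then - 2 * \<i> * of_real ((rho \<alpha> k)\<^sup>2) else 0)"
proof -
  \<comment> \<open>One argument will be a part of the coefficient \<open>k\<close>, so only the
    summand \<open>j = k\<close> can contribute.\<close>
  have al: "al_bracket n f g \<alpha> = c * (rho \<alpha> k)\<^sup>2"
    if "\<And>j. partial_u j f \<alpha> * partial_v j g \<alpha> - partial_v j f \<alpha> * partial_u j g \<alpha> =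
      (if j = k then c else 0)" for f g c
  proof -
    have "al_bracket n f g \<alpha> = (\<Sum>j < n - 1. if j = k then c * (rho \<alpha> k)\<^sup>2 else 0)"
      unfolding al_bracket_def that by (intro sum.cong) auto
    then show ?thesis using assms by simp
  qed
  let ?c = "if k = l then 1 else 0 :: real"
  have "al_bracket n (Re \<circ> (\<lambda>\<beta>. \<beta> k)) (Re \<circ> (\<lambda>\<beta>. \<beta> l)) \<alpha> = 0 * (rho \<alpha> k)\<^sup>2"
    "al_bracket n (Im \<circ> (\<lambda>\<beta>. \<beta> k)) (Im \<circ> (\<lambda>\<beta>. \<beta> l)) \<alpha> = 0 * (rho \<alpha> k)\<^sup>2"
    "al_bracket n (Re \<circ> (\<lambda>\<beta>. \<beta> k)) (Im \<circ> (\<lambda>\<beta>. \<beta> l)) \<alpha> = ?c * (rho \<alpha> k)\<^sup>2"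
    "al_bracket n (Im \<circ> (\<lambda>\<beta>. \<beta> k)) (Re \<circ> (\<lambda>\<beta>. \<beta> l)) \<alpha> = - ?c * (rho \<alpha> k)\<^sup>2"
    by (rule al; simp add: partial_Re_Im_coefficient)+
  then show "complexify (al_bracket n) (\<lambda>\<beta>. \<beta> k) (\<lambda>\<beta>. \<beta> l) \<alpha> = 0"
    by (simp add: complexify_def complex_eq_iff)
  have "al_bracket n (Re \<circ> (\<lambda>\<beta>. \<beta> k)) (Re \<circ> (\<lambda>\<beta>. cnj (\<beta> l))) \<alpha> = 0 * (rho \<alpha> k)\<^sup>2"
    "al_bracket n (Im \<circ> (\<lambda>\<beta>. \<beta> k)) (Im \<circ> (\<lambda>\<beta>. cnj (\<beta> l))) \<alpha> = 0 * (rho \<alpha> k)\<^sup>2"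
    "al_bracket n (Re \<circ> (\<lambda>\<beta>. \<beta> k)) (Im \<circ> (\<lambda>\<beta>. cnj (\<beta> l))) \<alpha> = - ?c * (rho \<alpha> k)\<^sup>2"
    "al_bracket n (Im \<circ> (\<lambda>\<beta>. \<beta> k)) (Re \<circ> (\<lambda>\<beta>. cnj (\<beta> l))) \<alpha> = - ?c * (rho \<alpha> k)\<^sup>2"
    by (rule al; simp add: partial_Re_Im_coefficient)+
  then show "complexify (al_bracket n) (\<lambda>\<beta>. \<beta> k) (\<lambda>\<beta>. cnj (\<beta> l)) \<alpha> =
      (if k = l then - 2 * \<i> * of_real ((rho \<alpha> k)\<^sup>2) else 0)"
    by (simp add: complexify_def complex_eq_iff)
qed

theorem theorem5p2:
  fixes \<alpha> :: "nat \<Rightarrow> complex"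
    and B :: "'n::{finite,linorder} cmat"
  assumes "verblunsky CARD('n) \<alpha>"
    and "B = cmv \<alpha>"
  shows "(\<forall>k l. k < CARD('n) - 1 \<and> l < CARD('n) - 1 \<longrightarrow>
            has_manifold_gd_bracket (\<lambda>\<beta>. \<beta> k) (\<lambda>\<beta>. \<beta> l) B 0 \<and>
            has_manifold_gd_bracket (\<lambda>\<beta>. \<beta> k) (\<lambda>\<beta>. cnj (\<beta> l)) B
              (if k = l then - 2 * \<i> * of_real ((rho \<alpha> k)\<^sup>2) else 0)) \<and>
         (\<forall>f g. smooth_on_manifold_at f B \<and> smooth_on_manifold_at g B \<longrightarrow>
            has_manifold_gd_bracket f g B (complexify (al_bracket CARD('n)) f g \<alpha>))"
proof -
  \<comment> \<open>The agreement of the brackets comes first; the coefficient formulas are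
    instances of it.\<close>
  have bracket: "has_manifold_gd_bracket f g B (complexify (al_bracket CARD('n)) f g \<alpha>)"
    if "smooth_on_manifold_at f B" "smooth_on_manifold_at g B" for f g
  proof -
    have "complexify gd_bracket \<phi> \<psi> B = complexify (al_bracket CARD('n)) f g \<alpha>"
      if "smooth_extension f \<phi> B" "smooth_extension g \<psi> B" for \<phi> \<psi>
      using that unfolding complexify_def assms(2)
      by (simp add: gd_bracket_extension[OF assms(1)] bounded_linear_Re bounded_linear_Im)
    then show ?thesis
      using that by (simp add: has_manifold_gd_bracket_def)
  qed
  have coefficient: "smooth_on_manifold_at (\<lambda>\<beta>. \<beta> k) B" "smooth_on_manifold_at (\<lambda>\<beta>. cnj (\<beta> k)) B"
    if "k < CARD('n) - 1" for k
    using assms that smooth_on_manifold_at_coefficient smooth_on_manifold_at_cnj by blast+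
  have "has_manifold_gd_bracket (\<lambda>\<beta>. \<beta> k) (\<lambda>\<beta>. \<beta> l) B 0 \<and>
      has_manifold_gd_bracket (\<lambda>\<beta>. \<beta> k) (\<lambda>\<beta>. cnj (\<beta> l)) B
        (if k = l then - 2 * \<i> * of_real ((rho \<alpha> k)\<^sup>2) else 0)"
    if "k < CARD('n) - 1" "l < CARD('n) - 1" for k l
    using bracket[OF coefficient(1) coefficient(1), OF that] bracket[OF coefficient(1) coefficient(2), OF that]
    unfolding al_bracket_coefficients[OF that(1)] by blast
  with bracket show ?thesis by blast
qed

end
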